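(* Let $n(R)$ be the supremum of the integers $N$ such that there exists a configuration $X_N=\{x_1,\ldots,x_N\}\subset D(a,R)$ satisfying the exclusion rule (this is independent of $a\in\mathbb{R}^2$). Then $$\varrho_{\max}:=\limsup_{R\to\infty}\frac{n(R)}{\pi R^2}\leq1.$$
   Context: $D(a,R)$ is the open disk of center $a$ and radius $R$. Screening sets: for distinct points $y_1,\ldots,y_K\in\mathbb{R}^2$, let $V_{\rm nuc}(x)=-\sum_{i=1}^K\log|x-y_i|$, $\mathcal{E}^{\rm TF}[\sigma]=-\int V_{\rm nuc}\sigma-\frac12\iint\sigma(x)\log|x-y|\sigma(y)\,dx\,dy$, minimized over $\{\sigma\in L^\infty\cap L^1(\mathbb{R}^2,\log(2+|x|)dx):0\le\sigma\le1,\int\sigma=K\}$; this has a unique minimizer $\sigma^{\rm TF}$. Let $\Phi^{\rm TF}=V_{\rm nuc}+\sigma^{\rm TF}*\log|\cdot|$ and $\Sigma^{\rm TF}(y_1,\ldots,y_K)=\{x:\Phi^{\rm TF}(x)>0\}$. A configuration $X_N\subset\mathbb{R}^2$ satisfies the exclusion rule if for every choice of distinct points $y_1,\ldots,y_K,y_{K+1}\in X_N$ one has $y_{K+1}\notin\Sigma^{\rm TF}(y_1,\ldots,y_K)$. *)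

theory Defs
  imports "HOL-Analysis.Analysis" "HOL-Library.Liminf_Limsup"
begin

type_synonym pt = "real ^ 2"

definition V_nuc :: "pt set \<Rightarrow> pt \<Rightarrow> real" where
  "V_nuc Y x = - (\<Sum>y\<in>Y. ln (dist x y))"

definition TF_admissible :: "pt set \<Rightarrow> (pt \<Rightarrow> real) \<Rightarrow> bool" where
  "TF_admissible Y \<sigma> \<longleftrightarrow>
     \<sigma> \<in> borel_measurable lborel \<and>
     (\<forall>x. 0 \<le> \<sigma> x \<and> \<sigma> x \<le> 1) \<and>
     integrable lborel (\<lambda>x. \<sigma> x * ln (2 + norm x)) \<and>
     integrable lborel \<sigma> \<and>
     (LINT x|lborel. \<sigma> x) = real (card Y)"

definition TF_energy :: "pt set \<Rightarrow> (pt \<Rightarrow> real) \<Rightarrow> real" where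
  "TF_energy Y \<sigma> =
     - (LINT x|lborel. V_nuc Y x * \<sigma> x)
     - (1/2) * (LINT x|lborel. (LINT y|lborel. \<sigma> x * ln (dist x y) * \<sigma> y))"

definition TF_minimizer :: "pt set \<Rightarrow> (pt \<Rightarrow> real) \<Rightarrow> bool" where
  "TF_minimizer Y \<sigma> \<longleftrightarrow> TF_admissible Y \<sigma> \<and>
     (\<forall>\<tau>. TF_admissible Y \<tau> \<longrightarrow> TF_energy Y \<sigma> \<le> TF_energy Y \<tau>)"

definition TF_potential :: "pt set \<Rightarrow> (pt \<Rightarrow> real) \<Rightarrow> pt \<Rightarrow> real" where
  "TF_potential Y \<sigma> x = V_nuc Y x + (LINT z|lborel. \<sigma> z * ln (dist x z))"

text \<open>Screening set. The minimizer is unique up to null sets and Phi does not depend on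
  the representative, so we quantify over all minimizers.\<close>
definition screening_set :: "pt set \<Rightarrow> pt set" where
  "screening_set Y = {x. \<forall>\<sigma>. TF_minimizer Y \<sigma> \<longrightarrow> TF_potential Y \<sigma> x > 0}"

definition exclusion_rule :: "pt set \<Rightarrow> bool" where
  "exclusion_rule X \<longleftrightarrow>
     (\<forall>Y y. Y \<subseteq> X \<and> Y \<noteq> {} \<and> y \<in> X \<and> y \<notin> Y \<longrightarrow> y \<notin> screening_set Y)"

text \<open>n(R) (for a disk centered at a), as an extended real (supremum may be infinite).\<close>
definition n_max :: "pt \<Rightarrow> real \<Rightarrow> ereal" where
  "n_max a R = Sup {ereal (real N) | N. \<exists>X. finite X \<and> card X = N \<and> X \<subseteq> ball a R \<and> exclusion_rule X}"

end

(* A Thomas-Fermi minimizer sigma satisfies Phi >= 0 away from the nuclei: where Phi < 0 the density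
vanishes, so there Phi is superharmonic, while Phi tends to 0 at infinity. If moreover Phi(x) <= 0,
comparing Phi(x) with its mean over the circle of radius r around x and using sigma <= 1 gives
  sum_y ln_+(r / |x - y|) <= int ln_+(r / |z|) dz = pi r^2 / 2.
Under the exclusion rule this holds for all x in X, with y ranging over X - {x}, and all r > 0.
Averaging over r with weight 2 q e^(-q^2), r = q S, turns ln_+ into a mixture of the Gaussians
e^(-|x - y|^2 / s^2) with weight ds / s, 0 < s < S. Gaussians are positive definite, so by Cauchy-Schwarz
their sum over all pairs of N points in a disc of radius R is at least about N^2 s^2 / R^2. The diagonal
contributes only O(N ln S) once s is cut off at 1, and comparing the two bounds gives
N <= (1 + o(1)) pi R^2 as R and then S tend to infinity. *)
theory Submission
  imports Defs "HOL-Complex_Analysis.Cauchy_Integral_Formula" "HOL-Real_Asymp.Real_Asymp"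
begin

text \<open>The obstacle is the diagonal: \<open>ln_+ (r / |x - y|)\<close> is singular at
  \<open>x = y\<close>, so a bound on the sum over pairs of distinct points cannot be completed to
  the full double sum to which Cauchy-Schwarz applies. Dropping the Gaussians of width below 1 from
  the mixture leaves a smaller kernel, for which the bound still holds, and one that is finite at 0.
  The leading constant survives this. The averaged right side is pi S^2 / 2, while points of density
  rho would give the integral of rho pi s^2 ds / s over 1 < s < S, that is rho pi (S^2 - 1) / 2; so
  rho is at most 1 up to terms of relative size ln S / S^2. Gaussians centred near the edge of the
  disc leak out of it. They are tested on a disc of radius R + l, where l has to be large against S
  and small against R; the final choice is l = S^2. On the Thomas-Fermi side all information comes
  from first variations that move mass between two bounded sets. The poles at the nuclei are dealt
  with by passing from Phi to exp(-Phi), which vanishes there.\<close>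

section \<open>Radial integrals in the plane\<close>

text \<open>Tonelli: integrating a layer-cake formula in \<open>z\<close> first turns each layer
  into the area of a disc of radius \<open>s\<close>. The truncated logarithm and the Gaussian both
  have such a formula, so their plane integrals become one-dimensional.\<close>

lemma nn_integral_radial:
  fixes k :: "real \<Rightarrow> ennreal" and x :: pt
  assumes [measurable]: "k \<in> borel_measurable borel"
  shows "(\<integral>\<^sup>+z. (\<integral>\<^sup>+s. k s * indicator {dist x z<..} s \<partial>lborel) \<partial>lborel)
       = (\<integral>\<^sup>+s. k s * ennreal (pi * s\<^sup>2) * indicator {0..} s \<partial>lborel)"
proof -
  have meas: "(\<lambda>(z, s). k s * (indicator {dist x z<..} s :: ennreal))
      \<in> borel_measurable (lborel \<Otimes>\<^sub>M lborel)"
  proof -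
    have "(\<lambda>p::pt \<times> real. k (snd p) * (if dist x (fst p) < snd p then 1 else 0))
      \<in> borel_measurable (lborel \<Otimes>\<^sub>M lborel)"
      by measurable
    moreover have "(\<lambda>(z, s). k s * (indicator {dist x z<..} s :: ennreal))
       = (\<lambda>p. k (snd p) * (if dist x (fst p) < snd p then 1 else 0))"
      by (auto simp: fun_eq_iff indicator_def)
    ultimately show ?thesis by simp
  qed
  have "(\<integral>\<^sup>+z. (\<integral>\<^sup>+s. k s * indicator {dist x z<..} s \<partial>lborel) \<partial>lborel)
      = (\<integral>\<^sup>+s. (\<integral>\<^sup>+z. k s * indicator {dist x z<..} s \<partial>lborel) \<partial>lborel)"
    by (rule lborel_pair.Fubini'[OF meas, symmetric])
  also have "\<dots> = (\<integral>\<^sup>+s. k s * ennreal (pi * s\<^sup>2) * indicator {0..} s \<partial>lborel)"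
  proof (rule nn_integral_cong)
    fix s :: real
    have "(\<integral>\<^sup>+z. k s * indicator {dist x z<..} s \<partial>lborel)
        = (\<integral>\<^sup>+z. k s * indicator (ball x s) z \<partial>lborel)"
      by (rule nn_integral_cong) (auto simp: indicator_def)
    also have "\<dots> = k s * emeasure lborel (ball x s)"
      by (rule nn_integral_cmult_indicator) auto
    also have "emeasure lborel (ball x s) = ennreal (pi * s\<^sup>2) * indicator {0..} s"
      by (cases "s \<ge> 0") (auto simp: emeasure_ball unit_ball_vol_2 ball_empty)
    finally show "(\<integral>\<^sup>+z. k s * indicator {dist x z<..} s \<partial>lborel)
        = k s * ennreal (pi * s\<^sup>2) * indicator {0..} s"
      by (simp add: mult.assoc)
  qed
  finally show ?thesis .
qed

text \<open>At \<open>d = 0\<close> the value is \<open>0\<close>, not \<open>\<infinity>\<close>, since \<open>r / 0 = 0\<close> and \<open>ln 0 = 0\<close>.\<close>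
definition log_cut :: "real \<Rightarrow> real \<Rightarrow> real" where
  "log_cut r d = max 0 (ln (r / d))"

lemma log_cut_nonneg: "0 \<le> log_cut r d"
  by (simp add: log_cut_def)

lemma log_cut_measurable[measurable]: "log_cut r \<in> borel_measurable borel"
  unfolding log_cut_def by measurable

lemma log_cut_eq_0: "0 < r \<Longrightarrow> r \<le> d \<Longrightarrow> log_cut r d = 0"
  by (simp add: log_cut_def)

text \<open>\<open>ln (max r d)\<close> will turn out to be the mean of the logarithm over a circle,
  so \<open>log_cut\<close> is exactly the excess of that mean over the value at the centre.\<close>

lemma ln_max_eq: "0 < r \<Longrightarrow> 0 < d \<Longrightarrow> ln (max r d) = ln d + log_cut r d"
  by (auto simp: log_cut_def ln_div max_def)

lemma nn_integral_inverse_Icc: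
  assumes "0 < a" "a \<le> b"
  shows "(\<integral>\<^sup>+s. ennreal (1 / s) * indicator {a..b} s \<partial>lborel) = ennreal (ln b - ln a)"
  using assms
  by (intro nn_integral_FTC_Icc) (auto intro!: derivative_eq_intros simp: field_simps)

text \<open>\<open>ln (r / d)\<close> is the integral of \<open>1 / s\<close> over the scales
  between \<open>d\<close> and \<open>r\<close>. The same formula yields the area integral of
  \<open>log_cut\<close> and, later, its decomposition into Gaussians.\<close>

lemma log_cut_layer:
  assumes "0 < r" "0 < d"
  shows "(\<integral>\<^sup>+s. ennreal (1 / s) * indicator {..r} s * indicator {d<..} s \<partial>lborel)
     = ennreal (log_cut r d)"
proof (cases "d \<le> r")
  case True
  have "(\<integral>\<^sup>+s. ennreal (1 / s) * indicator {..r} s * indicator {d<..} s \<partial>lborel)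
     = (\<integral>\<^sup>+s. ennreal (1 / s) * indicator {d..r} s \<partial>lborel)"
    using AE_lborel_singleton[of d]
    by (intro nn_integral_cong_AE) (auto simp: indicator_def elim!: eventually_mono)
  also have "\<dots> = ennreal (ln r - ln d)"
    by (rule nn_integral_inverse_Icc) (use assms True in auto)
  also have "ln r - ln d = log_cut r d"
    using assms True by (simp add: log_cut_def ln_div)
  finally show ?thesis .
next
  case False
  then have "(\<lambda>s. ennreal (1 / s) * indicator {..r} s * indicator {d<..} s) = (\<lambda>s. 0)"
    by (auto simp: indicator_def fun_eq_iff)
  then show ?thesis using False assms by (simp add: log_cut_eq_0)
qed

lemma nn_integral_log_cut:
  fixes x :: pt
  assumes "0 < r"
  shows "(\<integral>\<^sup>+z. ennreal (log_cut r (dist x z)) \<partial>lborel) = ennreal (pi * r\<^sup>2 / 2)"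
proof -
  have "(\<integral>\<^sup>+z. ennreal (log_cut r (dist x z)) \<partial>lborel)
      = (\<integral>\<^sup>+z. (\<integral>\<^sup>+s. ennreal (1 / s) * indicator {..r} s * indicator {dist x z<..} s \<partial>lborel) \<partial>lborel)"
  proof (rule nn_integral_cong_AE)
    \<comment> \<open>The two sides differ at \<open>z = x\<close>: the layer integral diverges
      there, while \<open>log_cut r 0 = 0\<close>.\<close>
    show "AE z in lborel. ennreal (log_cut r (dist x z)) =
       (\<integral>\<^sup>+s. ennreal (1 / s) * indicator {..r} s * indicator {dist x z<..} s \<partial>lborel)"
      using AE_lborel_singleton[of x] by eventually_elim (simp add: log_cut_layer assms)
  qed
  also have "\<dots> = (\<integral>\<^sup>+s. ennreal (1 / s) * indicator {..r} s * ennreal (pi * s\<^sup>2) * indicator {0..} s \<partial>lborel)"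
    by (rule nn_integral_radial) measurable
  also have "\<dots> = (\<integral>\<^sup>+s. ennreal (pi * s) * indicator {0..r} s \<partial>lborel)"
    by (rule nn_integral_cong)
      (auto simp: indicator_def power2_eq_square ennreal_mult[symmetric])
  also have "\<dots> = ennreal (pi * r\<^sup>2 / 2 - pi * 0\<^sup>2 / 2)"
    by (rule nn_integral_FTC_Icc) (use assms in \<open>auto intro!: derivative_eq_intros\<close>)
  finally show ?thesis by simp
qed

text \<open>The case \<open>c = 1\<close> is the average over radii that produces Gaussians from
  truncated logarithms; general \<open>c\<close> serves the plane integrals of Gaussians.\<close>

lemma gauss_layer:
  assumes "0 < c" "0 \<le> t"
  shows "(\<integral>\<^sup>+q. ennreal (2 * c * q * exp (- c * q\<^sup>2)) * indicator {t<..} q \<partial>lborel)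
     = ennreal (exp (- c * t\<^sup>2))"
proof -
  have "(\<integral>\<^sup>+q. ennreal (2 * c * q * exp (- c * q\<^sup>2)) * indicator {t<..} q \<partial>lborel)
     = (\<integral>\<^sup>+q. ennreal (2 * c * q * exp (- c * q\<^sup>2)) * indicator {t..} q \<partial>lborel)"
    using AE_lborel_singleton[of t]
    by (intro nn_integral_cong_AE) (auto simp: indicator_def elim!: eventually_mono)
  also have "\<dots> = ennreal (0 - (- exp (- c * t\<^sup>2)))"
  proof (rule nn_integral_FTC_atLeast)
    show "((\<lambda>q. - exp (- c * q\<^sup>2)) \<longlongrightarrow> 0) at_top"
      using assms by real_asymp
  qed (use assms in \<open>auto intro!: derivative_eq_intros\<close>)
  finally show ?thesis by simp
qed

lemma nn_integral_q3_gauss: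
  assumes "0 < c"
  shows "(\<integral>\<^sup>+q. ennreal (2 * c * q * exp (- c * q\<^sup>2)) * ennreal (pi * q\<^sup>2) * indicator {0..} q \<partial>lborel)
     = ennreal (pi / c)"
proof -
  have "(\<integral>\<^sup>+q. ennreal (2 * c * q * exp (- c * q\<^sup>2)) * ennreal (pi * q\<^sup>2) * indicator {0..} q \<partial>lborel)
     = (\<integral>\<^sup>+q. ennreal (2 * c * q * exp (- c * q\<^sup>2) * (pi * q\<^sup>2)) * indicator {0..} q \<partial>lborel)"
    by (rule nn_integral_cong) (use assms in \<open>auto simp: indicator_def ennreal_mult\<close>)
  also have "\<dots> = ennreal (0 - (- pi * (0\<^sup>2 + 1 / c) * exp (- c * 0\<^sup>2)))"
  proof (rule nn_integral_FTC_atLeast)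
    show "((\<lambda>q. - pi * (q\<^sup>2 + 1 / c) * exp (- c * q\<^sup>2)) \<longlongrightarrow> 0) at_top"
      using assms by real_asymp
  qed (use assms in \<open>auto intro!: derivative_eq_intros simp: field_simps power2_eq_square power3_eq_cube\<close>)
  finally show ?thesis by simp
qed

lemma nn_integral_gauss:
  fixes x :: pt
  assumes "0 < c"
  shows "(\<integral>\<^sup>+z. ennreal (exp (- c * (dist x z)\<^sup>2)) \<partial>lborel) = ennreal (pi / c)"
proof -
  have "(\<integral>\<^sup>+z. ennreal (exp (- c * (dist x z)\<^sup>2)) \<partial>lborel)
     = (\<integral>\<^sup>+z. (\<integral>\<^sup>+q. ennreal (2 * c * q * exp (- c * q\<^sup>2)) * indicator {dist x z<..} q \<partial>lborel) \<partial>lborel)"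
    by (simp only: gauss_layer[OF assms zero_le_dist])
  also have "\<dots> = ennreal (pi / c)"
    by (subst nn_integral_radial) (use nn_integral_q3_gauss[OF assms] in simp_all)
  finally show ?thesis .
qed

lemma integral_gauss:
  fixes x :: pt
  assumes "0 < c"
  shows "integrable lborel (\<lambda>z. exp (- c * (dist x z)\<^sup>2))"
    and "(LINT z|lborel. exp (- c * (dist x z)\<^sup>2)) = pi / c"
proof -
  have "has_bochner_integral lborel (\<lambda>z. exp (- c * (dist x z)\<^sup>2)) (pi / c)"
    by (rule has_bochner_integral_nn_integral) (use assms nn_integral_gauss[OF assms] in auto)
  then show "integrable lborel (\<lambda>z. exp (- c * (dist x z)\<^sup>2))"
    "(LINT z|lborel. exp (- c * (dist x z)\<^sup>2)) = pi / c"
    by (simp_all add: has_bochner_integral_iff)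
qed

lemma integral_log_cut:
  fixes x :: pt
  assumes "0 < r"
  shows "integrable lborel (\<lambda>z. log_cut r (dist x z))"
    and "(LINT z|lborel. log_cut r (dist x z)) = pi * r\<^sup>2 / 2"
proof -
  have "has_bochner_integral lborel (\<lambda>z. log_cut r (dist x z)) (pi * r\<^sup>2 / 2)"
    by (rule has_bochner_integral_nn_integral)
      (use assms nn_integral_log_cut[OF assms] in \<open>auto simp: log_cut_nonneg\<close>)
  then show "integrable lborel (\<lambda>z. log_cut r (dist x z))"
    "(LINT z|lborel. log_cut r (dist x z)) = pi * r\<^sup>2 / 2"
    by (simp_all add: has_bochner_integral_iff)
qed

section \<open>Circle means of the logarithm\<close>

definition circle_pt :: "pt \<Rightarrow> real \<Rightarrow> real \<Rightarrow> pt" where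
  "circle_pt p r t = p + r *\<^sub>R vector [cos t, sin t]"

lemma circle_pt_0: "circle_pt p r 0 = p + r *\<^sub>R axis 1 1"
  by (simp add: circle_pt_def vec_eq_iff forall_2 axis_def)

lemma continuous_on_circle_pt: "continuous_on A (circle_pt p r)"
proof -
  have "circle_pt p r = (\<lambda>t. p + r *\<^sub>R (\<chi> i. if i = 1 then cos t else sin t))"
    by (simp add: circle_pt_def fun_eq_iff vec_eq_iff forall_2)
  moreover have "continuous_on A (\<lambda>t. if i = 1 then cos t else sin t)" for i :: 2
    by (cases "i = 1") (auto intro: continuous_intros)
  ultimately show ?thesis
    by (auto intro!: continuous_intros)
qed

lemma circle_pt_measurable[measurable]: "circle_pt p r \<in> borel_measurable borel"
  by (intro borel_measurable_continuous_onI continuous_on_circle_pt)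

text \<open>Identifies the plane with the complex numbers, so that circle means of the logarithm can
  be obtained from Cauchy's formula.\<close>

lemma norm_pt: "norm (z :: pt) = cmod (Complex (z $ 1) (z $ 2))"
  by (simp add: norm_vec_def L2_set_def UNIV_2 cmod_def)

lemma dist_circle_pt:
  "dist (circle_pt p r t) w = cmod (of_real r * cis t - Complex ((w - p) $ 1) ((w - p) $ 2))"
proof -
  have "Complex ((circle_pt p r t - w) $ 1) ((circle_pt p r t - w) $ 2)
      = of_real r * cis t - Complex ((w - p) $ 1) ((w - p) $ 2)"
    by (simp add: circle_pt_def complex_eq_iff)
  then show ?thesis by (simp add: dist_norm norm_pt)
qed

lemma norm_vector_cos_sin: "norm (vector [cos t, sin t] :: pt) = 1"
  by (simp add: norm_pt cmod_def)

lemma dist_circle_pt_center: "dist (circle_pt p r t) p = \<bar>r\<bar>"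
  by (simp add: circle_pt_def dist_norm norm_vector_cos_sin)

text \<open>Mean value property: the integrand is the real part of
  \<open>Ln (1 - \<zeta> * u)\<close> on the unit circle. This function is holomorphic on the closed
  disc because \<open>\<zeta>\<close> lies inside it, and its value at the centre is 0.\<close>

lemma has_integral_ln_one_minus_cis:
  assumes "cmod \<zeta> < 1"
  shows "((\<lambda>t. ln (cmod (1 - \<zeta> * cis t))) has_integral 0) {0..2*pi}"
proof -
  \<comment> \<open>The real part of \<open>1 - \<zeta> * u\<close> is positive, which keeps it off
    the branch cut of \<open>Ln\<close>.\<close>
  have nz: "1 - \<zeta> * u \<notin> \<real>\<^sub>\<le>\<^sub>0" if "cmod u \<le> 1" for u
  proof
    assume "1 - \<zeta> * u \<in> \<real>\<^sub>\<le>\<^sub>0"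
    then have "Re (1 - \<zeta> * u) \<le> 0" by (simp add: complex_nonpos_Reals_iff)
    then have "1 \<le> Re (\<zeta> * u)" by simp
    also have "\<dots> \<le> cmod (\<zeta> * u)" by (rule complex_Re_le_cmod)
    also have "\<dots> \<le> cmod \<zeta> * 1" unfolding norm_mult by (intro mult_left_mono that) auto
    finally show False using assms by simp
  qed
  have hol: "(\<lambda>u. Ln (1 - \<zeta> * u)) holomorphic_on cball 0 1"
    using nz by (intro holomorphic_intros) auto
  have "((\<lambda>u. Ln (1 - \<zeta> * u) / (u - 0)) has_contour_integral (2 * of_real pi * \<i> * Ln (1 - \<zeta> * 0)))
         (circlepath 0 1)"
    by (rule Cauchy_integral_circlepath_simple[OF hol]) simp
  then have "((\<lambda>u. Ln (1 - \<zeta> * u) / u) has_contour_integral 0) (part_circlepath 0 1 0 (2 * pi))"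
    by (simp add: circlepath_def)
  then have "((\<lambda>t. Ln (1 - \<zeta> * cis t) / cis t * \<i> * cis t) has_integral 0) {0..2*pi}"
    by (subst (asm) has_contour_integral_part_circlepath_iff) auto
  \<comment> \<open>On the circle \<open>du / u\<close> is \<open>\<i> dt\<close>, so the imaginary
    part of the contour integrand is the real part of \<open>Ln\<close>, the logarithm of the
    modulus.\<close>
  then have "((\<lambda>t. Im (Ln (1 - \<zeta> * cis t) / cis t * \<i> * cis t)) has_integral Im 0) {0..2*pi}"
    by (rule has_integral_linear[OF _ bounded_linear_Im, unfolded o_def])
  moreover have "Im (Ln (1 - \<zeta> * cis t) / cis t * \<i> * cis t) = ln (cmod (1 - \<zeta> * cis t))" for t
  proof -
    have "1 - \<zeta> * cis t \<noteq> 0" using nz[of "cis t"] by auto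
    then show ?thesis by (simp add: field_simps)
  qed
  ultimately show ?thesis by simp
qed

text \<open>Factoring out the larger of \<open>r\<close> and \<open>dist p w\<close> leaves a
  quotient of modulus below 1. When \<open>w\<close> is inside the circle, the remaining factor is
  conjugated and multiplied by the unimodular \<open>cis t\<close> to bring it to the form
  \<open>1 - \<zeta> * cis t\<close>. On the circle itself \<open>\<zeta>\<close> would have modulus
  1 and the logarithm a singularity.\<close>

lemma dist_circle_pt_factor:
  assumes "0 < r" "dist p w \<noteq> r"
  obtains \<zeta> where "cmod \<zeta> < 1"
    "\<And>t. dist (circle_pt p r t) w = max r (dist p w) * cmod (1 - \<zeta> * cis t)"
proof -
  define \<omega> where "\<omega> = Complex ((w - p) $ 1) ((w - p) $ 2)"
  have \<omega>: "cmod \<omega> = dist p w"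
    by (simp only: \<omega>_def norm_pt[of "w - p", symmetric] dist_norm norm_minus_commute)
  have dc: "dist (circle_pt p r t) w = cmod (of_real r * cis t - \<omega>)" for t
    by (simp only: dist_circle_pt \<omega>_def)
  show ?thesis
  proof (cases "dist p w < r")
    case True
    have "cmod (of_real r * cis t - \<omega>) = r * cmod (1 - cnj (\<omega> / of_real r) * cis t)" for t
    proof -
      have "r * cmod (1 - cnj (\<omega> / of_real r) * cis t)
          = cmod (of_real r) * (cmod (cnj (1 - cnj (\<omega> / of_real r) * cis t)) * cmod (cis t))"
        using assms by (simp del: complex_cnj_diff complex_cnj_mult complex_cnj_divide)
      also have "\<dots> = cmod (of_real r * (cnj (1 - cnj (\<omega> / of_real r) * cis t) * cis t))"
        by (simp only: norm_mult)
      also have "of_real r * (cnj (1 - cnj (\<omega> / of_real r) * cis t) * cis t)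
          = of_real r * cis t - \<omega> * (cnj (cis t) * cis t)"
        using assms by (simp add: algebra_simps)
      also have "cnj (cis t) * cis t = 1" by (simp add: cis_cnj cis_mult)
      finally show ?thesis by simp
    qed
    then show ?thesis
      using True assms \<omega>
      by (intro that[of "cnj (\<omega> / of_real r)"]) (auto simp: dc norm_divide)
  next
    case False
    then have "\<omega> \<noteq> 0" using \<omega> assms by auto
    have "cmod (of_real r * cis t - \<omega>) = cmod \<omega> * cmod (1 - of_real r / \<omega> * cis t)" for t
    proof -
      have "\<omega> * (1 - of_real r / \<omega> * cis t) = - (of_real r * cis t - \<omega>)"
        using \<open>\<omega> \<noteq> 0\<close> by (simp add: field_simps)
      then show ?thesis by (metis norm_minus_cancel norm_mult)
    qed
    moreover have "r / dist p w < 1"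
      using False assms by (subst divide_less_eq_1_pos) auto
    ultimately show ?thesis
      using False assms \<omega>
      by (intro that[of "of_real r / \<omega>"]) (auto simp: dc norm_divide)
  qed
qed

text \<open>Newton's theorem for the planar Coulomb potential: a uniformly charged circle acts on
  the outside like a charge at its centre, and its potential is constant inside.\<close>

lemma circle_mean_ln:
  assumes "0 < r" "dist p w \<noteq> r"
  shows "set_integrable lborel {0..2*pi} (\<lambda>t. ln (dist (circle_pt p r t) w))"
    and "(LINT t:{0..2*pi}|lborel. ln (dist (circle_pt p r t) w)) = 2 * pi * ln (max r (dist p w))"
proof -
  obtain \<zeta> where \<zeta>: "cmod \<zeta> < 1"
    and eq: "\<And>t. dist (circle_pt p r t) w = max r (dist p w) * cmod (1 - \<zeta> * cis t)"
    using dist_circle_pt_factor[OF assms] by blast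
  have ne: "1 - \<zeta> * cis t \<noteq> 0" for t
    using \<zeta> by (metis eq_iff_diff_eq_0 less_irrefl mult.right_neutral norm_cis norm_mult norm_one)
  have ln_eq: "ln (dist (circle_pt p r t) w) = ln (max r (dist p w)) + ln (cmod (1 - \<zeta> * cis t))" for t
    using ne[of t] assms(1) by (simp add: eq ln_mult)
  have cont: "continuous_on {0..2*pi} (\<lambda>t. ln (dist (circle_pt p r t) w))"
    unfolding ln_eq using ne by (intro continuous_intros) auto
  show int: "set_integrable lborel {0..2*pi} (\<lambda>t. ln (dist (circle_pt p r t) w))"
    by (rule borel_integrable_compact[OF compact_Icc cont, folded set_integrable_def])
  have "((\<lambda>t. ln (dist (circle_pt p r t) w)) has_integral
      (LINT t:{0..2*pi}|lborel. ln (dist (circle_pt p r t) w))) {0..2*pi}"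
    using set_borel_integral_eq_integral[OF int] by (simp add: has_integral_integral)
  moreover have "((\<lambda>t. ln (dist (circle_pt p r t) w)) has_integral
      (ln (max r (dist p w)) * (2 * pi) + 0)) {0..2*pi}"
    unfolding ln_eq
    by (rule has_integral_add[OF _ has_integral_ln_one_minus_cis[OF \<zeta>]])
      (use has_integral_const_real[of "ln (max r (dist p w))" 0 "2*pi"] in \<open>simp add: mult.commute\<close>)
  ultimately show "(LINT t:{0..2*pi}|lborel. ln (dist (circle_pt p r t) w)) = 2 * pi * ln (max r (dist p w))"
    by (simp add: has_integral_unique mult.commute)
qed

section \<open>Logarithmic potentials and variations of the energy\<close>

text \<open>Boundedness tames the singularity of the kernel and the logarithmic moment its growth.
  In contrast to admissible densities, these functions form a vector space, so signed variations are
  included.\<close>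

definition log_density :: "(pt \<Rightarrow> real) \<Rightarrow> bool" where
  "log_density f \<longleftrightarrow> f \<in> borel_measurable lborel \<and> (\<exists>C. \<forall>x. \<bar>f x\<bar> \<le> C) \<and>
     integrable lborel (\<lambda>x. f x * ln (2 + norm x))"

definition log_pot :: "(pt \<Rightarrow> real) \<Rightarrow> pt \<Rightarrow> real" where
  "log_pot g z = (LINT w|lborel. g w * ln (dist z w))"

lemma ln_2_norm_pos: "0 < ln (2 + norm (x :: pt))"
  by (rule ln_gt_zero) (use norm_ge_zero[of x] in linarith)

lemma ln_2_norm_ge: "ln 2 \<le> ln (2 + norm (x :: pt))"
  by (rule ln_mono) (use norm_ge_zero[of x] in linarith)+

lemma log_densityD:
  assumes "log_density f"
  shows log_density_measurable: "f \<in> borel_measurable borel"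
    and log_density_integrable_ln: "integrable lborel (\<lambda>x. f x * ln (2 + norm x))"
    and log_density_integrable: "integrable lborel f"
proof -
  show *: "f \<in> borel_measurable borel" "integrable lborel (\<lambda>x. f x * ln (2 + norm x))"
    using assms by (auto simp: log_density_def)
  show "integrable lborel f"
  proof (rule Bochner_Integration.integrable_bound)
    show "integrable lborel (\<lambda>x. 1 / ln 2 * (f x * ln (2 + norm x)))"
      by (rule integrable_mult_right[OF *(2)])
    show "AE x in lborel. norm (f x) \<le> norm (1 / ln 2 * (f x * ln (2 + norm x)))"
    proof (rule AE_I2)
      fix x :: pt
      have "\<bar>f x\<bar> * ln 2 \<le> \<bar>f x\<bar> * ln (2 + norm x)"
        by (intro mult_left_mono ln_2_norm_ge) auto
      then show "norm (f x) \<le> norm (1 / ln 2 * (f x * ln (2 + norm x)))"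
        using ln_2_norm_pos[of x] by (simp add: abs_mult field_simps)
    qed
  qed (use * in auto)
qed

lemma log_density_bound:
  assumes "log_density f"
  obtains C where "0 \<le> C" "\<And>x. \<bar>f x\<bar> \<le> C"
  using assms unfolding log_density_def by (metis abs_ge_zero order_trans)

lemma log_density_add:
  assumes "log_density f" "log_density g"
  shows "log_density (\<lambda>x. f x + g x)"
proof -
  obtain C D where "\<And>x. \<bar>f x\<bar> \<le> C" "\<And>x. \<bar>g x\<bar> \<le> D"
    using log_density_bound assms by metis
  then have "\<bar>f x + g x\<bar> \<le> C + D" for x
    by (meson abs_triangle_ineq add_mono order_trans)
  moreover have "integrable lborel (\<lambda>x. f x * ln (2 + norm x) + g x * ln (2 + norm x))"
    using assms by (auto simp: log_density_def)
  ultimately show ?thesis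
    using assms unfolding log_density_def by (auto simp: algebra_simps)
qed

lemma log_density_cmult:
  assumes "log_density f"
  shows "log_density (\<lambda>x. c * f x)"
proof -
  obtain C where "\<And>x. \<bar>f x\<bar> \<le> C"
    using log_density_bound assms by metis
  then have "\<bar>c * f x\<bar> \<le> \<bar>c\<bar> * C" for x
    by (simp add: abs_mult mult_left_mono)
  moreover have "integrable lborel (\<lambda>x. c * (f x * ln (2 + norm x)))"
    using assms by (auto simp: log_density_def)
  ultimately show ?thesis
    using assms unfolding log_density_def by (auto simp: mult.assoc)
qed

lemma log_density_indicator:
  fixes A :: "pt set"
  assumes "A \<in> sets borel" "bounded A"
  shows "log_density (indicator A)"
proof -
  obtain R where R: "\<And>x. x \<in> A \<Longrightarrow> norm x \<le> R"
    using assms(2) by (auto simp: bounded_iff)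
  have "integrable lborel (\<lambda>x. indicator A x * ln (2 + norm x))"
  proof (rule Bochner_Integration.integrable_bound)
    have "emeasure lborel A < \<infinity>"
      using assms(2) by (rule emeasure_bounded_finite)
    then show "integrable lborel (\<lambda>x. indicator A x * ln (2 + R))"
      using assms by auto
    show "AE x in lborel. norm (indicator A x * ln (2 + norm x)) \<le> norm (indicator A x * ln (2 + R))"
    proof (rule AE_I2)
      fix x :: pt
      have "ln (2 + norm x) \<le> ln (2 + R)" if "x \<in> A"
        using R[OF that] norm_ge_zero[of x] by (intro ln_mono) linarith+
      then show "norm (indicator A x * ln (2 + norm x)) \<le> norm (indicator A x * ln (2 + R))"
        using ln_2_norm_pos[of x] by (auto simp: indicator_def)
    qed
  qed (use assms in auto)
  moreover have "\<bar>indicator A x\<bar> \<le> (1::real)" for x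
    by (auto simp: indicator_def)
  ultimately show ?thesis
    using assms unfolding log_density_def by auto
qed

lemma TF_admissible_log_density: "TF_admissible Y \<sigma> \<Longrightarrow> log_density \<sigma>"
  unfolding TF_admissible_def log_density_def by (auto intro!: exI[of _ 1] simp: abs_le_iff order_trans[of _ 0])

section \<open>The logarithmic kernel against bounded densities\<close>

lemma ln_dist_le: "ln (dist z w) \<le> ln (2 + norm z) + ln (2 + norm (w::pt))"
proof (cases "0 < dist z w")
  case True
  have "dist z w \<le> norm z + norm w" unfolding dist_norm by (rule norm_triangle_ineq4)
  also have "\<dots> \<le> (2 + norm z) * (2 + norm w)"
    by (simp add: algebra_simps)
  finally have "ln (dist z w) \<le> ln ((2 + norm z) * (2 + norm w))"
    using True by (intro ln_mono) auto
  also have "\<dots> = ln (2 + norm z) + ln (2 + norm w)"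
    by (rule ln_mult_pos) (use norm_ge_zero[of z] norm_ge_zero[of w] in linarith)+
  finally show ?thesis .
next
  case False
  then show ?thesis using ln_2_norm_pos[of z] ln_2_norm_pos[of w] by simp
qed

text \<open>Separates growth at infinity, to be paid by the logarithmic moment, from the local
  singularity, to be paid by boundedness since \<open>log_cut 1\<close> is integrable.\<close>

lemma abs_ln_dist_le:
  "\<bar>ln (dist z w)\<bar> \<le> ln (2 + norm z) + ln (2 + norm w) + log_cut 1 (dist z (w::pt))"
proof (cases "0 < dist z w \<and> dist z w \<le> 1")
  case True
  then have "\<bar>ln (dist z w)\<bar> = log_cut 1 (dist z w)"
    by (simp add: log_cut_def ln_div del: zero_less_dist_iff)
  then show ?thesis using ln_2_norm_pos[of z] ln_2_norm_pos[of w] by simp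
next
  case False
  then have "0 \<le> ln (dist z w)" by (cases "z = w") auto
  then show ?thesis using ln_dist_le[of z w] log_cut_nonneg[of 1 "dist z w"] by simp
qed

lemma log_density_log_cut_integrable:
  assumes "log_density g" "0 < r"
  shows "integrable lborel (\<lambda>w. g w * log_cut r (dist z w))"
proof -
  obtain C where C: "0 \<le> C" "\<And>x. \<bar>g x\<bar> \<le> C"
    using log_density_bound assms by metis
  show ?thesis
  proof (rule Bochner_Integration.integrable_bound)
    show "integrable lborel (\<lambda>w. C * log_cut r (dist z w))"
      by (intro integrable_mult_right integral_log_cut assms)
    show "AE w in lborel. norm (g w * log_cut r (dist z w)) \<le> norm (C * log_cut r (dist z w))"
      using C by (auto simp: abs_mult intro!: mult_right_mono)
  qed (use log_density_measurable[OF assms(1)] in measurable)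
qed

lemma log_density_abs: "log_density f \<Longrightarrow> log_density (\<lambda>x. \<bar>f x\<bar>)"
proof -
  assume f: "log_density f"
  have "integrable lborel (\<lambda>x. \<bar>f x * ln (2 + norm x)\<bar>)"
    using log_density_integrable_ln[OF f] by (rule integrable_abs)
  then show ?thesis
    using f ln_2_norm_pos unfolding log_density_def by (auto simp: abs_mult less_imp_le)
qed

text \<open>The bound grows like \<open>ln (2 + norm z)\<close>, which is precisely what a second
  \<open>log_density\<close> can integrate. Hence the double integrals with the logarithmic kernel
  converge absolutely and Fubini applies to them.\<close>

lemma log_density_ln_dist:
  assumes g: "log_density g"
  shows log_density_ln_dist_integrable: "integrable lborel (\<lambda>w. g w * ln (dist z w))"
    and log_density_ln_dist_bound: "\<exists>C\<ge>0. \<forall>z. (LINT w|lborel. \<bar>g w * ln (dist z w)\<bar>) \<le> C * ln (2 + norm z)"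
proof -
  note [measurable] = log_density_measurable[OF g]
  define D where "D z w = \<bar>g w\<bar> * ln (2 + norm z) + \<bar>g w\<bar> * ln (2 + norm w) + \<bar>g w\<bar> * log_cut 1 (dist z w)"
    for z w
  have D_int: "integrable lborel (D z)" for z
    unfolding D_def using log_density_abs[OF g]
    by (intro Bochner_Integration.integrable_add integrable_mult_left log_density_integrable log_density_integrable_ln
        log_density_log_cut_integrable) auto
  have D_le: "\<bar>g w * ln (dist z w)\<bar> \<le> D z w" for z w
  proof -
    have "\<bar>g w * ln (dist z w)\<bar>
        \<le> \<bar>g w\<bar> * (ln (2 + norm z) + ln (2 + norm w) + log_cut 1 (dist z w))"
      unfolding abs_mult by (intro mult_left_mono abs_ln_dist_le) auto
    then show ?thesis by (simp add: D_def algebra_simps)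
  qed
  show int: "integrable lborel (\<lambda>w. g w * ln (dist z w))" for z
    by (rule Bochner_Integration.integrable_bound[OF D_int[of z]])
      (use D_le in \<open>auto intro: order_trans[OF _ abs_ge_self]\<close>)
  obtain C where C: "0 \<le> C" "\<And>x. \<bar>g x\<bar> \<le> C"
    using log_density_bound g by metis
  define a where "a = (LINT w|lborel. \<bar>g w\<bar>)"
  define b where "b = (LINT w|lborel. \<bar>g w\<bar> * ln (2 + norm w)) + C * (pi / 2)"
  have b0: "0 \<le> b"
    unfolding b_def using C ln_2_norm_pos
    by (intro add_nonneg_nonneg Bochner_Integration.integral_nonneg) (auto simp: less_imp_le)
  have a0: "0 \<le> a" unfolding a_def by simp
  have "(LINT w|lborel. \<bar>g w * ln (dist z w)\<bar>) \<le> (a + b / ln 2) * ln (2 + norm z)" for z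
  proof -
    have "(LINT w|lborel. \<bar>g w * ln (dist z w)\<bar>) \<le> (LINT w|lborel. D z w)"
      by (intro integral_mono integrable_abs int D_int D_le)
    also have "\<dots> = a * ln (2 + norm z) + (LINT w|lborel. \<bar>g w\<bar> * ln (2 + norm w))
        + (LINT w|lborel. \<bar>g w\<bar> * log_cut 1 (dist z w))"
      unfolding D_def a_def
      using log_density_integrable[OF log_density_abs[OF g]] log_density_integrable_ln[OF log_density_abs[OF g]]
        log_density_log_cut_integrable[OF log_density_abs[OF g], of 1 z]
      by simp
    also have "(LINT w|lborel. \<bar>g w\<bar> * log_cut 1 (dist z w)) \<le> (LINT w|lborel. C * log_cut 1 (dist z w))"
      using C by (intro integral_mono log_density_log_cut_integrable log_density_abs g integrable_mult_right
          integral_log_cut mult_right_mono) (auto simp: log_cut_nonneg)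
    also have "\<dots> = C * (pi / 2)"
      using integral_log_cut(2)[of 1 z] by simp
    finally have "(LINT w|lborel. \<bar>g w * ln (dist z w)\<bar>) \<le> a * ln (2 + norm z) + b"
      by (simp add: b_def)
    also have "b \<le> b / ln 2 * ln (2 + norm z)"
      using mult_left_mono[OF ln_2_norm_ge[of z] b0] by (simp add: field_simps)
    finally show ?thesis by (simp add: algebra_simps)
  qed
  then show "\<exists>C\<ge>0. \<forall>z. (LINT w|lborel. \<bar>g w * ln (dist z w)\<bar>) \<le> C * ln (2 + norm z)"
    using a0 b0 by (intro exI[of _ "a + b / ln 2"]) auto
qed

lemma log_density_pair_integrable:
  assumes f: "log_density f" and g: "log_density g"
  shows "integrable (lborel \<Otimes>\<^sub>M lborel) (\<lambda>(z, w). f z * (g w * ln (dist z w)))"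
proof -
  note [measurable] = log_density_measurable[OF f] log_density_measurable[OF g]
  obtain C where C: "0 \<le> C" "\<And>z. (LINT w|lborel. \<bar>g w * ln (dist z w)\<bar>) \<le> C * ln (2 + norm z)"
    using log_density_ln_dist_bound[OF g] by blast
  show ?thesis
  proof (rule lborel_pair.Fubini_integrable)
    show "integrable lborel (\<lambda>x. LINT y|lborel. norm (case (x, y) of (z, w) \<Rightarrow> f z * (g w * ln (dist z w))))"
    proof (rule Bochner_Integration.integrable_bound)
      show "integrable lborel (\<lambda>z. C * (f z * ln (2 + norm z)))"
        by (rule integrable_mult_right[OF log_density_integrable_ln[OF f]])
      show "AE x in lborel. norm (LINT y|lborel. norm (case (x, y) of (z, w) \<Rightarrow> f z * (g w * ln (dist z w))))
         \<le> norm (C * (f x * ln (2 + norm x)))"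
      proof (rule AE_I2)
        fix x :: pt
        have "(LINT y|lborel. norm (case (x, y) of (z, w) \<Rightarrow> f z * (g w * ln (dist z w))))
           = \<bar>f x\<bar> * (LINT w|lborel. \<bar>g w * ln (dist x w)\<bar>)"
          by (simp add: abs_mult)
        also have "\<dots> \<le> \<bar>f x\<bar> * (C * ln (2 + norm x))"
          by (intro mult_left_mono C) auto
        finally show "norm (LINT y|lborel. norm (case (x, y) of (z, w) \<Rightarrow> f z * (g w * ln (dist z w))))
         \<le> norm (C * (f x * ln (2 + norm x)))"
          using C(1) ln_2_norm_pos[of x] by (simp add: abs_mult mult.left_commute)
      qed
    qed measurable
    show "AE x in lborel. integrable lborel (\<lambda>y. case (x, y) of (z, w) \<Rightarrow> f z * (g w * ln (dist z w)))"
      using log_density_ln_dist_integrable[OF g] by simp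
  qed measurable
qed

lemma log_density_times_log_pot_integrable:
  assumes "log_density f" "log_density g"
  shows "integrable lborel (\<lambda>z. f z * log_pot g z)"
  using lborel_pair.integrable_fst'[OF log_density_pair_integrable[OF assms]]
  by (simp add: log_pot_def)

lemma log_pot_symmetric:
  assumes "log_density f" "log_density g"
  shows "(LINT z|lborel. f z * log_pot g z) = (LINT z|lborel. g z * log_pot f z)"
proof -
  have "(LINT z|lborel. f z * log_pot g z) = (LINT z|lborel. LINT w|lborel. f z * (g w * ln (dist z w)))"
    by (simp add: log_pot_def)
  also have "\<dots> = (LINT w|lborel. LINT z|lborel. f z * (g w * ln (dist z w)))"
    by (rule lborel_pair.Fubini_integral[symmetric, OF log_density_pair_integrable[OF assms]])
  also have "\<dots> = (LINT z|lborel. g z * log_pot f z)"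
  proof -
    have "(LINT z|lborel. f z * (g w * ln (dist z w))) = g w * log_pot f w" for w
      by (simp add: log_pot_def dist_commute[of _ w] mult.left_commute[of "f _" "g w"])
    then show ?thesis by simp
  qed
  finally show ?thesis .
qed

lemma log_pot_add: "log_density f \<Longrightarrow> log_density g \<Longrightarrow> log_pot (\<lambda>x. f x + g x) z = log_pot f z + log_pot g z"
  unfolding log_pot_def by (simp add: distrib_right log_density_ln_dist_integrable)

lemma log_pot_cmult: "log_pot (\<lambda>x. c * f x) z = c * log_pot f z"
  unfolding log_pot_def by (simp add: mult.assoc)

lemma log_density_times_V_nuc_integrable:
  assumes "log_density f" shows "integrable lborel (\<lambda>z. V_nuc Y z * f z)"
proof -
  have "integrable lborel (\<lambda>z. \<Sum>y\<in>Y. f z * ln (dist y z))"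
    by (intro Bochner_Integration.integrable_sum log_density_ln_dist_integrable assms)
  then have "integrable lborel (\<lambda>z. - (\<Sum>y\<in>Y. f z * ln (dist y z)))"
    by (rule Bochner_Integration.integrable_minus)
  then show ?thesis
    by (simp add: V_nuc_def sum_distrib_left dist_commute mult.commute)
qed

lemma TF_potential_eq: "TF_potential Y \<sigma> z = V_nuc Y z + log_pot \<sigma> z"
  by (simp add: TF_potential_def log_pot_def)

lemma log_density_times_TF_potential_integrable:
  assumes "log_density \<sigma>" "log_density f"
  shows "integrable lborel (\<lambda>z. TF_potential Y \<sigma> z * f z)"
proof -
  have "integrable lborel (\<lambda>z. V_nuc Y z * f z + f z * log_pot \<sigma> z)"
    by (intro Bochner_Integration.integrable_add log_density_times_V_nuc_integrable log_density_times_log_pot_integrable assms)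
  then show ?thesis by (simp add: TF_potential_eq algebra_simps)
qed

section \<open>The energy as a quadratic functional and its first variation\<close>

lemma TF_energy_eq:
  "TF_energy Y \<sigma> = - (LINT z|lborel. V_nuc Y z * \<sigma> z) - 1/2 * (LINT z|lborel. \<sigma> z * log_pot \<sigma> z)"
proof -
  have "(LINT y|lborel. \<sigma> x * ln (dist x y) * \<sigma> y) = \<sigma> x * log_pot \<sigma> x" for x
    unfolding log_pot_def by (simp add: mult_ac flip: integral_mult_right_zero)
  then show ?thesis by (simp add: TF_energy_def)
qed

text \<open>The energy is quadratic and its two cross terms agree by symmetry of the kernel, so the
  expansion is exact. It exhibits \<open>- TF_potential\<close> as the first variation.\<close>

lemma TF_energy_add:
  assumes \<sigma>: "log_density \<sigma>" and \<delta>: "log_density \<delta>"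
  shows "TF_energy Y (\<lambda>x. \<sigma> x + e * \<delta> x) = TF_energy Y \<sigma>
     - e * (LINT z|lborel. TF_potential Y \<sigma> z * \<delta> z) - e\<^sup>2 / 2 * (LINT z|lborel. \<delta> z * log_pot \<delta> z)"
proof -
  note e\<delta> = log_density_cmult[OF \<delta>, of e]
  note int = log_density_times_log_pot_integrable[OF \<sigma> \<sigma>] log_density_times_log_pot_integrable[OF \<sigma> \<delta>]
    log_density_times_log_pot_integrable[OF \<delta> \<sigma>] log_density_times_log_pot_integrable[OF \<delta> \<delta>]
    log_density_times_V_nuc_integrable[OF \<sigma>] log_density_times_V_nuc_integrable[OF \<delta>]
  have "(LINT z|lborel. V_nuc Y z * (\<sigma> z + e * \<delta> z))
      = (LINT z|lborel. V_nuc Y z * \<sigma> z + e * (V_nuc Y z * \<delta> z))"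
    by (simp add: algebra_simps)
  also have "\<dots> = (LINT z|lborel. V_nuc Y z * \<sigma> z) + e * (LINT z|lborel. V_nuc Y z * \<delta> z)"
    using int by simp
  finally have V: "(LINT z|lborel. V_nuc Y z * (\<sigma> z + e * \<delta> z))
      = (LINT z|lborel. V_nuc Y z * \<sigma> z) + e * (LINT z|lborel. V_nuc Y z * \<delta> z)" .
  have "(LINT z|lborel. (\<sigma> z + e * \<delta> z) * log_pot (\<lambda>x. \<sigma> x + e * \<delta> x) z)
      = (LINT z|lborel. \<sigma> z * log_pot \<sigma> z + e * (\<sigma> z * log_pot \<delta> z) + e * (\<delta> z * log_pot \<sigma> z) + e\<^sup>2 * (\<delta> z * log_pot \<delta> z))"
    unfolding log_pot_add[OF \<sigma> e\<delta>] log_pot_cmult by (simp add: algebra_simps power2_eq_square)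
  also have "\<dots> = (LINT z|lborel. \<sigma> z * log_pot \<sigma> z) + e * (LINT z|lborel. \<sigma> z * log_pot \<delta> z)
      + e * (LINT z|lborel. \<delta> z * log_pot \<sigma> z) + e\<^sup>2 * (LINT z|lborel. \<delta> z * log_pot \<delta> z)"
    using int by simp
  also have "(LINT z|lborel. \<sigma> z * log_pot \<delta> z) = (LINT z|lborel. \<delta> z * log_pot \<sigma> z)"
    by (rule log_pot_symmetric[OF \<sigma> \<delta>])
  finally have P: "(LINT z|lborel. (\<sigma> z + e * \<delta> z) * log_pot (\<lambda>x. \<sigma> x + e * \<delta> x) z)
      = (LINT z|lborel. \<sigma> z * log_pot \<sigma> z) + 2 * e * (LINT z|lborel. \<delta> z * log_pot \<sigma> z)
      + e\<^sup>2 * (LINT z|lborel. \<delta> z * log_pot \<delta> z)" by simp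
  have "(LINT z|lborel. TF_potential Y \<sigma> z * \<delta> z)
      = (LINT z|lborel. V_nuc Y z * \<delta> z + \<delta> z * log_pot \<sigma> z)"
    by (simp add: TF_potential_eq algebra_simps)
  also have "\<dots> = (LINT z|lborel. V_nuc Y z * \<delta> z) + (LINT z|lborel. \<delta> z * log_pot \<sigma> z)"
    using int by simp
  finally show ?thesis
    unfolding TF_energy_eq V P by (simp add: algebra_simps)
qed

text \<open>Were the linear term a gain, it would beat the quadratic term for small
  \<open>e\<close>, whatever the sign of the latter, and the energy could be lowered.\<close>

lemma TF_minimizer_first_order:
  assumes min: "TF_minimizer Y \<sigma>" and \<delta>: "log_density \<delta>" and zero: "(LINT z|lborel. \<delta> z) = 0"
    and "0 < e0" and adm: "\<And>e z. 0 < e \<Longrightarrow> e \<le> e0 \<Longrightarrow> 0 \<le> \<sigma> z + e * \<delta> z \<and> \<sigma> z + e * \<delta> z \<le> 1"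
  shows "(LINT z|lborel. TF_potential Y \<sigma> z * \<delta> z) \<le> 0"
proof (rule ccontr)
  define a where "a = (LINT z|lborel. TF_potential Y \<sigma> z * \<delta> z)"
  define b where "b = (LINT z|lborel. \<delta> z * log_pot \<delta> z)"
  assume "\<not> a \<le> 0" 
  then have "0 < a" by simp
  have \<sigma>: "TF_admissible Y \<sigma>" using min by (simp add: TF_minimizer_def)
  note n\<sigma> = TF_admissible_log_density[OF \<sigma>]
  \<comment> \<open>This makes \<open>e * \<bar>b\<bar> < a\<close>, so the quadratic term is below
    half of the linear gain \<open>e * a\<close>.\<close>
  define e where "e = min e0 (a / (\<bar>b\<bar> + 1))"
  have e: "0 < e" "e \<le> e0"
    using \<open>0 < a\<close> \<open>0 < e0\<close> by (auto simp: e_def)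
  have "e \<le> a / (\<bar>b\<bar> + 1)" by (simp add: e_def)
  then have e': "e * \<bar>b\<bar> + e \<le> a"
    by (subst (asm) pos_le_divide_eq) (auto simp: algebra_simps)
  have log_density: "log_density (\<lambda>x. \<sigma> x + e * \<delta> x)"
    by (intro log_density_add log_density_cmult n\<sigma> \<delta>)
  have "TF_admissible Y (\<lambda>x. \<sigma> x + e * \<delta> x)"
    unfolding TF_admissible_def
  proof (intro conjI allI)
    show "(\<lambda>x. \<sigma> x + e * \<delta> x) \<in> borel_measurable lborel"
      using log_density_measurable[OF log_density] by simp
    show "integrable lborel (\<lambda>x. (\<sigma> x + e * \<delta> x) * ln (2 + norm x))"
      by (rule log_density_integrable_ln[OF log_density])
    show "integrable lborel (\<lambda>x. \<sigma> x + e * \<delta> x)"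
      by (rule log_density_integrable[OF log_density])
    show "(LINT x|lborel. \<sigma> x + e * \<delta> x) = real (card Y)"
      using \<sigma> zero log_density_integrable[OF \<delta>] by (simp add: TF_admissible_def)
  qed (use adm e in auto)
  then have "TF_energy Y \<sigma> \<le> TF_energy Y (\<lambda>x. \<sigma> x + e * \<delta> x)"
    using min by (simp add: TF_minimizer_def)
  then have "e * a + e\<^sup>2 / 2 * b \<le> 0"
    unfolding TF_energy_add[OF n\<sigma> \<delta>] a_def b_def by simp
  then have "e * (a + e / 2 * b) \<le> 0"
    by (simp add: power2_eq_square algebra_simps)
  then have "a + e / 2 * b \<le> 0"
    using e(1) by (simp add: mult_le_0_iff)
  moreover have "e / 2 * b \<ge> - (e / 2 * \<bar>b\<bar>)"
    using e(1) mult_left_mono[of "- \<bar>b\<bar>" b "e / 2"] by simp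
  moreover have "e * \<bar>b\<bar> < a"
    using e e' by simp
  ultimately show False using \<open>0 < a\<close> by (simp add: field_simps)
qed

text \<open>Mass is moved from \<open>A\<close> to \<open>B\<close>, each indicator being weighted
  by the area of the other set so that the total is preserved; the margin \<open>\<eta>\<close>
  keeps the density in the unit interval. For sets of positive area the conclusion compares
  averages: the mean potential on \<open>B\<close> is at most that on \<open>A\<close>. The product
  form also covers null sets.\<close>

lemma TF_minimizer_exchange:
  fixes A B :: "pt set"
  assumes min: "TF_minimizer Y \<sigma>"
    and A: "A \<in> sets borel" "bounded A" and B: "B \<in> sets borel" "bounded B" and "A \<inter> B = {}"
    and "0 < \<eta>" and A\<eta>: "\<And>z. z \<in> A \<Longrightarrow> \<eta> \<le> \<sigma> z" and B\<eta>: "\<And>z. z \<in> B \<Longrightarrow> \<sigma> z \<le> 1 - \<eta>"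
  shows "measure lborel A * (LINT z|lborel. TF_potential Y \<sigma> z * indicator B z)
       \<le> measure lborel B * (LINT z|lborel. TF_potential Y \<sigma> z * indicator A z)"
proof -
  define \<alpha> \<beta> where "\<alpha> = measure lborel A" and "\<beta> = measure lborel B"
  have ab: "0 \<le> \<alpha>" "0 \<le> \<beta>" by (auto simp: \<alpha>_def \<beta>_def)
  have \<sigma>: "TF_admissible Y \<sigma>" using min by (simp add: TF_minimizer_def)
  note n\<sigma> = TF_admissible_log_density[OF \<sigma>]
  note nA = log_density_indicator[OF A] and nB = log_density_indicator[OF B]
  have \<delta>: "log_density (\<lambda>z. \<alpha> * indicator B z + (-\<beta>) * indicator A z)"
    by (intro log_density_add log_density_cmult nA nB)
  note int = log_density_times_TF_potential_integrable[OF n\<sigma>]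
  have "(LINT z|lborel. TF_potential Y \<sigma> z * (\<alpha> * indicator B z + (-\<beta>) * indicator A z)) \<le> 0"
  proof (rule TF_minimizer_first_order[OF min \<delta>])
    show "(LINT z|lborel. \<alpha> * indicator B z + (-\<beta>) * indicator A z) = 0"
      using log_density_integrable[OF nA] log_density_integrable[OF nB] by (simp add: \<alpha>_def \<beta>_def)
    show "0 < \<eta> / (1 + \<alpha> + \<beta>)" using ab \<open>0 < \<eta>\<close> by simp
    fix e z assume e: "0 < e" "e \<le> \<eta> / (1 + \<alpha> + \<beta>)"
    then have "e * (1 + \<alpha> + \<beta>) \<le> \<eta>"
      using ab by (subst (asm) pos_le_divide_eq) auto
    then have "e + e * \<alpha> + e * \<beta> \<le> \<eta>" by (simp add: algebra_simps)
    moreover have "0 \<le> e * \<alpha>" "0 \<le> e * \<beta>" using e(1) ab by auto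
    ultimately have *: "e * \<alpha> \<le> \<eta>" "e * \<beta> \<le> \<eta>" "0 \<le> e * \<alpha>" "0 \<le> e * \<beta>"
      using e(1) by linarith+
    have \<sigma>z: "0 \<le> \<sigma> z" "\<sigma> z \<le> 1" using \<sigma> by (auto simp: TF_admissible_def)
    consider "z \<in> A" "z \<notin> B" | "z \<in> B" "z \<notin> A" | "z \<notin> A" "z \<notin> B"
      using \<open>A \<inter> B = {}\<close> by blast
    then show "0 \<le> \<sigma> z + e * (\<alpha> * indicator B z + (-\<beta>) * indicator A z) \<and>
        \<sigma> z + e * (\<alpha> * indicator B z + (-\<beta>) * indicator A z) \<le> 1"
    proof cases
      case 1
      then show ?thesis using A\<eta>[of z] * \<sigma>z by simp
    next
      case 2
      then show ?thesis using B\<eta>[of z] * \<sigma>z by simp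
    next
      case 3
      then show ?thesis using \<sigma>z by simp
    qed
  qed
  also have "(LINT z|lborel. TF_potential Y \<sigma> z * (\<alpha> * indicator B z + (-\<beta>) * indicator A z))
     = (LINT z|lborel. \<alpha> * (TF_potential Y \<sigma> z * indicator B z) - \<beta> * (TF_potential Y \<sigma> z * indicator A z))"
    by (simp add: algebra_simps)
  also have "\<dots> = \<alpha> * (LINT z|lborel. TF_potential Y \<sigma> z * indicator B z)
     - \<beta> * (LINT z|lborel. TF_potential Y \<sigma> z * indicator A z)"
    using int[OF nA] int[OF nB] by simp
  finally show ?thesis by (simp add: \<alpha>_def \<beta>_def)
qed

section \<open>Continuity and behaviour at infinity\<close>

text \<open>Regularization of the kernel at scale \<open>\<epsilon>\<close>. The pointwise identity
  behind it can fail only at \<open>w = z\<close>, where \<open>ln 0 = 0\<close>. With a small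
  \<open>\<epsilon>\<close> this gives continuity and the limit at infinity; with
  \<open>\<epsilon>\<close> the radius of a circle it rewrites a circle mean.\<close>

lemma log_pot_split:
  assumes g: "log_density g" and "0 < \<epsilon>"
  shows integrable_ln_max: "integrable lborel (\<lambda>w. g w * ln (max \<epsilon> (dist z w)))"
    and "(LINT w|lborel. g w * ln (max \<epsilon> (dist z w))) = log_pot g z + (LINT w|lborel. g w * log_cut \<epsilon> (dist z w))"
proof -
  note [measurable] = log_density_measurable[OF g]
  have ae: "AE w in lborel. g w * ln (dist z w) + g w * log_cut \<epsilon> (dist z w) = g w * ln (max \<epsilon> (dist z w))"
    using AE_lborel_singleton[of z]
  proof eventually_elim
    case (elim w)
    then have "ln (max \<epsilon> (dist z w)) = ln (dist z w) + log_cut \<epsilon> (dist z w)"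
      by (intro ln_max_eq assms) auto
    then show ?case by (simp add: algebra_simps)
  qed
  have i: "integrable lborel (\<lambda>w. g w * ln (dist z w))" "integrable lborel (\<lambda>w. g w * log_cut \<epsilon> (dist z w))"
    by (intro log_density_ln_dist_integrable log_density_log_cut_integrable assms)+
  then have s: "integrable lborel (\<lambda>w. g w * ln (dist z w) + g w * log_cut \<epsilon> (dist z w))"
    by simp
  show "integrable lborel (\<lambda>w. g w * ln (max \<epsilon> (dist z w)))"
    by (rule integrable_cong_AE_imp[OF s _ ae]) measurable
  have "(LINT w|lborel. g w * ln (max \<epsilon> (dist z w)))
      = (LINT w|lborel. g w * ln (dist z w) + g w * log_cut \<epsilon> (dist z w))"
    by (rule integral_cong_AE[symmetric, OF _ _ ae]) measurable
  then show "(LINT w|lborel. g w * ln (max \<epsilon> (dist z w))) = log_pot g z + (LINT w|lborel. g w * log_cut \<epsilon> (dist z w))"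
    using i by (simp add: log_pot_def)
qed

lemma density_log_cut_bounds:
  assumes g: "log_density g" "\<And>z. 0 \<le> g z" "\<And>z. g z \<le> 1" and "0 < r"
  shows "0 \<le> (LINT w|lborel. g w * log_cut r (dist z w))"
    and "(LINT w|lborel. g w * log_cut r (dist z w)) \<le> pi * r\<^sup>2 / 2"
proof -
  show "0 \<le> (LINT w|lborel. g w * log_cut r (dist z w))"
    by (simp add: g log_cut_nonneg)
  have "(LINT w|lborel. g w * log_cut r (dist z w)) \<le> (LINT w|lborel. log_cut r (dist z w))"
    using mult_right_mono[OF g(3) log_cut_nonneg]
    by (intro integral_mono log_density_log_cut_integrable integral_log_cut assms) auto
  then show "(LINT w|lborel. g w * log_cut r (dist z w)) \<le> pi * r\<^sup>2 / 2"
    using integral_log_cut(2)[OF \<open>0 < r\<close>, of z] by simp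
qed

lemma abs_ln_max_dist_le:
  fixes z w :: pt
  assumes "0 < \<epsilon>"
  shows "\<bar>ln (max \<epsilon> (dist z w))\<bar> \<le> \<bar>ln \<epsilon>\<bar> + ln (2 + norm z) + ln (2 + norm w)"
proof (cases "dist z w \<le> \<epsilon>")
  case True
  then show ?thesis using ln_2_norm_pos[of z] ln_2_norm_pos[of w] by (simp add: max_def)
next
  case False
  then have "ln \<epsilon> \<le> ln (dist z w)" using assms by (intro ln_mono) auto
  then show ?thesis
    using False ln_dist_le[of z w] ln_2_norm_pos[of z] ln_2_norm_pos[of w] by (simp add: max_def)
qed

lemma continuous_log_pot_truncated:
  assumes g: "log_density g" and "0 < \<epsilon>"
  shows "continuous_on UNIV (\<lambda>z. LINT w|lborel. g w * ln (max \<epsilon> (dist z w)))"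
proof (rule continuous_at_imp_continuous_on, intro ballI)
  fix z :: pt
  note [measurable] = log_density_measurable[OF g]
  show "isCont (\<lambda>z. LINT w|lborel. g w * ln (max \<epsilon> (dist z w))) z"
    unfolding continuous_at_sequentially o_def
  proof (intro allI impI)
    fix x :: "nat \<Rightarrow> pt" assume x: "x \<longlonglongrightarrow> z"
    then obtain M where M: "\<And>n. norm (x n) \<le> M"
      using convergent_imp_Bseq[OF convergentI] by (metis BseqD)
    show "(\<lambda>n. LINT w|lborel. g w * ln (max \<epsilon> (dist (x n) w)))
        \<longlonglongrightarrow> (LINT w|lborel. g w * ln (max \<epsilon> (dist z w)))"
    proof (rule integral_dominated_convergence)
      show "integrable lborel (\<lambda>w. \<bar>g w\<bar> * (\<bar>ln \<epsilon>\<bar> + ln (2 + M)) + \<bar>g w\<bar> * ln (2 + norm w))"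
        using log_density_integrable[OF log_density_abs[OF g]] log_density_integrable_ln[OF log_density_abs[OF g]] by simp
      show "AE w in lborel. (\<lambda>n. g w * ln (max \<epsilon> (dist (x n) w))) \<longlonglongrightarrow> g w * ln (max \<epsilon> (dist z w))"
        using \<open>0 < \<epsilon>\<close> by (intro AE_I2 tendsto_intros x) auto
      show "AE w in lborel. norm (g w * ln (max \<epsilon> (dist (x n) w)))
          \<le> \<bar>g w\<bar> * (\<bar>ln \<epsilon>\<bar> + ln (2 + M)) + \<bar>g w\<bar> * ln (2 + norm w)" for n
      proof (rule AE_I2)
        fix w :: pt
        have "ln (2 + norm (x n)) \<le> ln (2 + M)"
          using M[of n] norm_ge_zero[of "x n"] by (intro ln_mono) linarith+
        then have "\<bar>ln (max \<epsilon> (dist (x n) w))\<bar> \<le> \<bar>ln \<epsilon>\<bar> + ln (2 + M) + ln (2 + norm w)"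
          using abs_ln_max_dist_le[OF \<open>0 < \<epsilon>\<close>, of "x n" w] by simp
        then have "norm (g w * ln (max \<epsilon> (dist (x n) w))) \<le> \<bar>g w\<bar> * (\<bar>ln \<epsilon>\<bar> + ln (2 + M) + ln (2 + norm w))"
          by (auto simp: abs_mult intro: mult_left_mono)
        then show "norm (g w * ln (max \<epsilon> (dist (x n) w)))
          \<le> \<bar>g w\<bar> * (\<bar>ln \<epsilon>\<bar> + ln (2 + M)) + \<bar>g w\<bar> * ln (2 + norm w)"
          by (simp add: algebra_simps)
      qed
    qed measurable
  qed
qed

text \<open>The potential is a uniform limit of its truncations: at scale
  \<open>1 / real (Suc n)\<close> the error is at most \<open>pi / 2\<close> times the square of
  that scale, at every point.\<close>

lemma continuous_log_pot:
  assumes g: "log_density g" "\<And>z. 0 \<le> g z" "\<And>z. g z \<le> 1"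
  shows "continuous_on UNIV (log_pot g)"
proof (rule uniform_limit_theorem)
  define T where "T n z = (LINT w|lborel. g w * ln (max (1 / real (Suc n)) (dist z w)))" for n z
  show "\<forall>\<^sub>F n in sequentially. continuous_on UNIV (T n)"
    unfolding T_def by (intro always_eventually allI continuous_log_pot_truncated g) auto
  show "uniform_limit UNIV T (log_pot g) sequentially"
  proof (rule uniform_limitI)
    fix e :: real assume "0 < e"
    have "(\<lambda>n. pi * (1 / real (Suc n))\<^sup>2 / 2) \<longlonglongrightarrow> 0" by real_asymp
    then have "\<forall>\<^sub>F n in sequentially. pi * (1 / real (Suc n))\<^sup>2 / 2 < e"
      using \<open>0 < e\<close> by (rule order_tendstoD)
    then show "\<forall>\<^sub>F n in sequentially. \<forall>x\<in>UNIV. dist (T n x) (log_pot g x) < e"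
    proof eventually_elim
      case (elim n)
      show ?case
      proof
        fix z
        have "T n z - log_pot g z = (LINT w|lborel. g w * log_cut (1 / real (Suc n)) (dist z w))"
          unfolding T_def by (subst log_pot_split) (use g in auto)
        then show "dist (T n z) (log_pot g z) < e"
          using density_log_cut_bounds[OF g, of "1 / real (Suc n)" z] elim
          by (simp add: dist_real_def)
      qed
    qed
  qed
qed simp

lemma ln_max_dist_asymp:
  fixes x :: "nat \<Rightarrow> pt"
  assumes x: "filterlim (\<lambda>n. norm (x n)) at_top sequentially" and "0 < \<epsilon>"
  shows "(\<lambda>n. ln (max \<epsilon> (dist (x n) w)) - ln (norm (x n))) \<longlonglongrightarrow> 0"
proof (rule real_tendsto_sandwich)
  define c where "c = norm w"
  have "((\<lambda>N::real. ln (N - c) - ln N) \<longlongrightarrow> 0) at_top" by real_asymp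
  then show "(\<lambda>n. ln (norm (x n) - c) - ln (norm (x n))) \<longlonglongrightarrow> 0"
    by (rule filterlim_compose[OF _ x])
  have "((\<lambda>N::real. ln (N + c) - ln N) \<longlongrightarrow> 0) at_top" by real_asymp
  then show "(\<lambda>n. ln (norm (x n) + c) - ln (norm (x n))) \<longlonglongrightarrow> 0"
    by (rule filterlim_compose[OF _ x])
  have ev: "\<forall>\<^sub>F n in sequentially. c + \<epsilon> < norm (x n)"
    using x by (simp add: filterlim_at_top_dense)
  have b: "norm (x n) - c \<le> dist (x n) w" "dist (x n) w \<le> norm (x n) + c" for n
    unfolding c_def dist_norm by (rule norm_triangle_ineq2, rule norm_triangle_ineq4)
  show "\<forall>\<^sub>F n in sequentially. ln (norm (x n) - c) - ln (norm (x n))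
      \<le> ln (max \<epsilon> (dist (x n) w)) - ln (norm (x n))"
    using ev
  proof eventually_elim
    case (elim n)
    then show ?case using b[of n] \<open>0 < \<epsilon>\<close> by (auto intro!: ln_mono)
  qed
  show "\<forall>\<^sub>F n in sequentially. ln (max \<epsilon> (dist (x n) w)) - ln (norm (x n))
      \<le> ln (norm (x n) + c) - ln (norm (x n))"
    using ev
  proof eventually_elim
    case (elim n)
    moreover have "0 \<le> c" by (simp add: c_def)
    ultimately have "max \<epsilon> (dist (x n) w) \<le> norm (x n) + c" using b[of n] by simp
    then show ?case using \<open>0 < \<epsilon>\<close> by (auto intro!: ln_mono)
  qed
qed

text \<open>The right side is free of \<open>z\<close>; it provides the dominating function for the
  limit at infinity.\<close>

lemma abs_ln_max_dist_minus_ln_le: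
  fixes z w :: pt
  assumes "0 < \<epsilon>" "\<epsilon> \<le> 1" "1 \<le> norm z"
  shows "\<bar>ln (max \<epsilon> (dist z w)) - ln (norm z)\<bar> \<le> ln (2 + norm w) - ln \<epsilon>"
proof -
  define m where "m = max \<epsilon> (dist z w)"
  have m: "0 < m" "\<epsilon> \<le> m" using assms by (auto simp: m_def)
  have w2: "0 < 2 + norm w" using norm_ge_zero[of w] by linarith
  have "m \<le> norm z * (2 + norm w)"
  proof -
    have "dist z w \<le> norm z + norm w" unfolding dist_norm by (rule norm_triangle_ineq4)
    moreover have "norm w \<le> norm z * norm w" using mult_right_mono[OF assms(3), of "norm w"] by simp
    ultimately have "dist z w \<le> norm z * (2 + norm w)" using assms by (simp add: algebra_simps)
    moreover have "1 * 1 \<le> norm z * (2 + norm w)"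
      using assms norm_ge_zero[of w] by (intro mult_mono) linarith+
    ultimately show ?thesis using assms by (simp add: m_def)
  qed
  then have "ln m \<le> ln (norm z * (2 + norm w))" using m by (intro ln_mono) auto
  also have "\<dots> = ln (norm z) + ln (2 + norm w)"
    by (rule ln_mult_pos) (use assms w2 in auto)
  finally have 1: "ln m \<le> ln (norm z) + ln (2 + norm w)" .
  have "norm z * \<epsilon> \<le> m * (2 + norm w)"
  proof -
    have "norm z \<le> dist z w + norm w" unfolding dist_norm using norm_triangle_ineq2[of z w] by simp
    also have "\<dots> \<le> m + norm w" by (simp add: m_def)
    finally have "norm z * \<epsilon> \<le> (m + norm w) * \<epsilon>" using assms by (intro mult_right_mono) auto
    also have "\<dots> = m * \<epsilon> + norm w * \<epsilon>" by (simp add: algebra_simps)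
    also have "\<dots> \<le> m * 2 + norm w * m" using m assms by (intro add_mono mult_left_mono) auto
    finally show ?thesis by (simp add: algebra_simps)
  qed
  then have "ln (norm z * \<epsilon>) \<le> ln (m * (2 + norm w))"
    by (intro ln_mono mult_pos_pos) (use assms in linarith)+
  moreover have "ln (norm z * \<epsilon>) = ln (norm z) + ln \<epsilon>" by (rule ln_mult_pos) (use assms in auto)
  moreover have "ln (m * (2 + norm w)) = ln m + ln (2 + norm w)" by (rule ln_mult_pos) (use m w2 in auto)
  ultimately have 2: "ln (norm z) + ln \<epsilon> \<le> ln m + ln (2 + norm w)" by simp
  have "ln \<epsilon> \<le> 0" using assms by simp
  then show ?thesis using 1 2 unfolding m_def[symmetric] by linarith
qed

text \<open>Neutrality: the density has mass \<open>card Y\<close>, so the terms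
  \<open>ln (norm z)\<close> of nuclei and density cancel. The density may reach out to infinity, so
  the part close to \<open>z\<close> is truncated at scale \<open>\<epsilon>\<close> at a cost of at
  most \<open>\<eta> / 2\<close>; the rest tends to 0 by dominated convergence along a
  sequence.\<close>

lemma TF_potential_at_infinity:
  assumes \<sigma>: "TF_admissible Y \<sigma>" and "finite Y" and "0 < \<eta>"
  obtains \<rho> where "\<And>z. \<rho> \<le> norm z \<Longrightarrow> - \<eta> \<le> TF_potential Y \<sigma> z"
proof (rule ccontr)
  note n\<sigma> = TF_admissible_log_density[OF \<sigma>]
  have \<sigma>01: "\<And>z. 0 \<le> \<sigma> z" "\<And>z. \<sigma> z \<le> 1" and mass: "(LINT w|lborel. \<sigma> w) = real (card Y)"
    using \<sigma> by (auto simp: TF_admissible_def)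
  note [measurable] = log_density_measurable[OF n\<sigma>]
  assume "\<not> thesis"
  then have "\<exists>z. real n \<le> norm z \<and> TF_potential Y \<sigma> z < - \<eta>" for n
    using that[of "real n"] by (meson not_le)
  then obtain x where x: "\<And>n. real n \<le> norm (x n)" "\<And>n. TF_potential Y \<sigma> (x n) < - \<eta>"
    by metis
  have lim: "filterlim (\<lambda>n. norm (x n)) at_top sequentially"
    by (rule filterlim_at_top_mono[OF filterlim_real_sequentially]) (simp add: x)
  \<comment> \<open>Because \<open>\<epsilon>\<close> is at most 1 and pi is below 4, the truncation
    error \<open>pi * \<epsilon>^2 / 2\<close> is at most \<open>\<eta> / 2\<close>.\<close>
  define \<epsilon> where "\<epsilon> = min 1 (\<eta> / 4)"
  have \<epsilon>: "0 < \<epsilon>" "\<epsilon> \<le> 1" "\<epsilon> \<le> \<eta> / 4" using \<open>0 < \<eta>\<close> by (auto simp: \<epsilon>_def)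
  have "\<epsilon>\<^sup>2 \<le> \<epsilon>" using \<epsilon> by (simp add: power2_eq_square mult_left_le)
  then have "pi * \<epsilon>\<^sup>2 \<le> 4 * (\<eta> / 4)" using \<epsilon> pi_less_4 by (intro mult_mono) auto
  then have \<epsilon>\<eta>: "pi * \<epsilon>\<^sup>2 / 2 \<le> \<eta> / 2" by simp
  define L where "L n w = ln (max \<epsilon> (dist (x n) w)) - ln (norm (x n))" for n w
  have L: "(\<lambda>n. L n w) \<longlonglongrightarrow> 0" for w
    unfolding L_def by (rule ln_max_dist_asymp[OF lim \<epsilon>(1)])
  have J: "(\<lambda>n. LINT w|lborel. \<sigma> w * L n w) \<longlonglongrightarrow> 0"
  proof -
    \<comment> \<open>The shift to \<open>Suc n\<close> ensures norm at least 1, as the dominating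
      function demands.\<close>
    have "(\<lambda>n. LINT w|lborel. \<sigma> w * L (Suc n) w) \<longlonglongrightarrow> (LINT w::pt|lborel. 0)"
    proof (rule integral_dominated_convergence)
      show "integrable lborel (\<lambda>w. \<sigma> w * ln (2 + norm w) + \<sigma> w * (- ln \<epsilon>))"
        using log_density_integrable[OF n\<sigma>] log_density_integrable_ln[OF n\<sigma>] by simp
      show "AE w in lborel. (\<lambda>n. \<sigma> w * L (Suc n) w) \<longlonglongrightarrow> 0"
        using L[THEN LIMSEQ_Suc] by (auto intro!: tendsto_mult_right_zero)
      show "AE w in lborel. norm (\<sigma> w * L (Suc n) w) \<le> \<sigma> w * ln (2 + norm w) + \<sigma> w * (- ln \<epsilon>)" for n
      proof (rule AE_I2)
        fix w :: pt
        have "1 \<le> norm (x (Suc n))" using x(1)[of "Suc n"] by simp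
        then have "\<bar>L (Suc n) w\<bar> \<le> ln (2 + norm w) - ln \<epsilon>"
          unfolding L_def by (intro abs_ln_max_dist_minus_ln_le \<epsilon>)
        then have "\<sigma> w * \<bar>L (Suc n) w\<bar> \<le> \<sigma> w * (ln (2 + norm w) - ln \<epsilon>)"
          by (intro mult_left_mono \<sigma>01)
        then show "norm (\<sigma> w * L (Suc n) w) \<le> \<sigma> w * ln (2 + norm w) + \<sigma> w * (- ln \<epsilon>)"
          using \<sigma>01(1)[of w] by (simp add: abs_mult algebra_simps)
      qed
    qed (auto simp: L_def)
    then show ?thesis by (subst (asm) filterlim_sequentially_Suc) simp
  qed
  have "(\<lambda>n. (LINT w|lborel. \<sigma> w * L n w) - (\<Sum>y\<in>Y. L n y)) \<longlonglongrightarrow> 0 - (\<Sum>y\<in>Y. 0)"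
    by (intro tendsto_intros J L)
  then have ev1: "\<forall>\<^sub>F n in sequentially. - (\<eta> / 2) < (LINT w|lborel. \<sigma> w * L n w) - (\<Sum>y\<in>Y. L n y)"
    using \<open>0 < \<eta>\<close> by (intro order_tendstoD(1)) auto
  \<comment> \<open>At a nucleus the value \<open>ln 0 = 0\<close> can break this inequality. The
    sequence eventually stays clear of the nuclei.\<close>
  have Vge: "V_nuc Y z \<ge> - (\<Sum>y\<in>Y. ln (max \<epsilon> (dist z y)))" if "\<And>y. y \<in> Y \<Longrightarrow> z \<noteq> y" for z
    unfolding V_nuc_def neg_le_iff_le using that by (intro sum_mono ln_mono) auto
  have ev2: "\<forall>\<^sub>F n in sequentially. \<forall>y\<in>Y. x n \<noteq> y"
  proof -
    have "\<forall>\<^sub>F n in sequentially. x n \<noteq> y" for y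
    proof -
      have "\<forall>\<^sub>F n in sequentially. norm y < norm (x n)"
        using lim by (simp add: filterlim_at_top_dense)
      then show ?thesis by eventually_elim auto
    qed
    then show ?thesis using \<open>finite Y\<close> by (simp add: eventually_ball_finite)
  qed
  from ev1 ev2 have "\<forall>\<^sub>F n in sequentially. False"
  proof eventually_elim
    case (elim n)
    have "(LINT w|lborel. \<sigma> w * L n w)
       = (LINT w|lborel. \<sigma> w * ln (max \<epsilon> (dist (x n) w)) - \<sigma> w * ln (norm (x n)))"
      by (simp add: L_def algebra_simps)
    also have "\<dots> = (LINT w|lborel. \<sigma> w * ln (max \<epsilon> (dist (x n) w))) - real (card Y) * ln (norm (x n))"
      using integrable_ln_max[OF n\<sigma> \<epsilon>(1), of "x n"] log_density_integrable[OF n\<sigma>] by (simp add: mass)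
    also have "(LINT w|lborel. \<sigma> w * ln (max \<epsilon> (dist (x n) w)))
        = log_pot \<sigma> (x n) + (LINT w|lborel. \<sigma> w * log_cut \<epsilon> (dist (x n) w))"
      by (rule log_pot_split[OF n\<sigma> \<epsilon>(1)])
    also have "\<dots> \<le> log_pot \<sigma> (x n) + \<eta> / 2"
      using density_log_cut_bounds(2)[OF n\<sigma> \<sigma>01 \<epsilon>(1), of "x n"] \<epsilon>\<eta> by simp
    finally have "(LINT w|lborel. \<sigma> w * L n w) \<le> log_pot \<sigma> (x n) + \<eta> / 2 - real (card Y) * ln (norm (x n))"
      by simp
    moreover have "(\<Sum>y\<in>Y. L n y) = (\<Sum>y\<in>Y. ln (max \<epsilon> (dist (x n) y))) - real (card Y) * ln (norm (x n))"
      by (simp add: L_def sum_subtractf)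
    ultimately show False
      using elim(1) Vge[of "x n"] x(2)[of n] elim(2) by (auto simp: TF_potential_eq)
  qed
  then show False by simp
qed

text \<open>Mass in \<open>D\<close> could be carried with profit to a remote set \<open>B\<close>,
  where the potential is at least \<open>- \<eta> / 2\<close> and the density leaves room.\<close>

lemma TF_minimizer_vanishes:
  assumes min: "TF_minimizer Y \<sigma>" and "finite Y" and "0 < \<eta>"
    and D: "D \<in> sets borel" "bounded D" and neg: "\<And>z. z \<in> D \<Longrightarrow> TF_potential Y \<sigma> z \<le> - \<eta>"
  shows "AE z in lborel. z \<in> D \<longrightarrow> \<sigma> z = 0"
proof -
  have \<sigma>: "TF_admissible Y \<sigma>" using min by (simp add: TF_minimizer_def)
  note n\<sigma> = TF_admissible_log_density[OF \<sigma>]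
  note [measurable] = log_density_measurable[OF n\<sigma>] D(1)
  have \<sigma>01: "\<And>z. 0 \<le> \<sigma> z" "\<And>z. \<sigma> z \<le> 1" and mass: "(LINT w|lborel. \<sigma> w) = real (card Y)"
    using \<sigma> by (auto simp: TF_admissible_def)
  note int = log_density_times_TF_potential_integrable[OF n\<sigma>]
  obtain \<rho> where \<rho>: "\<And>z. \<rho> \<le> norm z \<Longrightarrow> - (\<eta> / 2) \<le> TF_potential Y \<sigma> z"
    using TF_potential_at_infinity[OF \<sigma> \<open>finite Y\<close>, of "\<eta> / 2"] \<open>0 < \<eta>\<close> by auto
  \<comment> \<open>The density exceeds 1/2 on an area of at most \<open>2 * card Y\<close>. A disc
    of radius \<open>l\<close> has more area than that, so a part \<open>B\<close> of positive
    measure remains; the centre \<open>c\<close> puts the disc beyond radius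
    \<open>\<rho>\<close>.\<close>
  define l where "l = 2 * real (card Y) + 1"
  have l: "1 \<le> l" by (simp add: l_def)
  define c :: pt where "c = (\<bar>\<rho>\<bar> + l) *\<^sub>R axis 1 1"
  define B where "B = {z \<in> ball c l. \<sigma> z \<le> 1/2}"
  have B[measurable]: "B \<in> sets borel" unfolding B_def by measurable
  have bB: "bounded B" by (rule bounded_subset[OF bounded_ball[of c l]]) (auto simp: B_def)
  have far: "- (\<eta> / 2) \<le> TF_potential Y \<sigma> z" if "z \<in> B" for z
  proof (rule \<rho>)
    have "norm c = \<bar>\<rho>\<bar> + l" using l by (simp add: c_def)
    moreover have "norm c \<le> dist c z + norm z"
      unfolding dist_norm using norm_triangle_ineq2[of c z] by simp
    moreover have "dist c z < l" using that by (simp add: B_def)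
    ultimately show "\<rho> \<le> norm z" by linarith
  qed
  have mB: "0 < measure lborel B"
  proof -
    have ib: "integrable lborel (indicator (ball c l) :: pt \<Rightarrow> real)" "integrable lborel (indicator B :: pt \<Rightarrow> real)"
      using log_density_integrable[OF log_density_indicator[of "ball c l"]] log_density_integrable[OF log_density_indicator[OF B bB]] by auto
    have "(LINT z|lborel. 1/2 * indicator (ball c l) z) \<le> (LINT z|lborel. \<sigma> z + 1/2 * indicator B z)"
    proof (rule integral_mono)
      show "1/2 * indicator (ball c l) z \<le> \<sigma> z + 1/2 * indicator B z" for z
        using \<sigma>01(1)[of z] by (cases "\<sigma> z \<le> 1/2") (auto simp: B_def split: split_indicator)
    qed (use ib log_density_integrable[OF n\<sigma>] in auto)
    then have "measure lborel (ball c l) / 2 \<le> real (card Y) + measure lborel B / 2"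
      using ib log_density_integrable[OF n\<sigma>] by (simp add: mass)
    moreover have "measure lborel (ball c l) = pi * l\<^sup>2"
      using l by (simp add: content_ball unit_ball_vol_2)
    moreover have "1 * l \<le> pi * l\<^sup>2"
      using l pi_gt3 by (intro mult_mono) (auto simp: power2_eq_square)
    ultimately show ?thesis by (simp add: l_def)
  qed
  \<comment> \<open>Level sets are treated one at a time. The level \<open>1 / real (n + 2)\<close>
    is at most 1/2, so it is also a valid margin on \<open>B\<close>.\<close>
  have null: "AE z in lborel. z \<in> D \<longrightarrow> \<sigma> z < 1 / real (n + 2)" for n
  proof -
    define A where "A = {z \<in> D. 1 / real (n + 2) \<le> \<sigma> z}"
    have A[measurable]: "A \<in> sets borel" unfolding A_def by measurable
    have bA: "bounded A" by (rule bounded_subset[OF D(2)]) (auto simp: A_def)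
    have disj: "A \<inter> B = {}" using far neg \<open>0 < \<eta>\<close> by (fastforce simp: A_def)
    note nA = log_density_indicator[OF A bA] and nB = log_density_indicator[OF B bB]
    have "measure lborel A * (LINT z|lborel. TF_potential Y \<sigma> z * indicator B z)
       \<le> measure lborel B * (LINT z|lborel. TF_potential Y \<sigma> z * indicator A z)"
    proof (rule TF_minimizer_exchange[OF min A bA B bB disj, of "1 / real (n + 2)"])
      have n: "1 / real (n + 2) \<le> 1 / 2" by (simp add: field_simps)
      show "\<sigma> z \<le> 1 - 1 / real (n + 2)" if "z \<in> B" for z
      proof -
        have "\<sigma> z \<le> 1 / 2" using that by (simp add: B_def)
        then show ?thesis using n by linarith
      qed
    qed (auto simp: A_def)
    also have "(LINT z|lborel. TF_potential Y \<sigma> z * indicator A z) \<le> (LINT z|lborel. - \<eta> * indicator A z)"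
    proof (intro integral_mono int nA integrable_mult_right log_density_integrable)
      show "TF_potential Y \<sigma> z * indicator A z \<le> - \<eta> * indicator A z" for z
        using neg[of z] by (cases "z \<in> A") (auto simp: A_def)
    qed
    also have "\<dots> = - \<eta> * measure lborel A" using log_density_integrable[OF nA] by simp
    finally have "measure lborel A * (LINT z|lborel. TF_potential Y \<sigma> z * indicator B z)
        \<le> measure lborel B * (- \<eta> * measure lborel A)"
      by (auto simp: mult_left_mono)
    moreover have "(LINT z|lborel. - (\<eta> / 2) * indicator B z) \<le> (LINT z|lborel. TF_potential Y \<sigma> z * indicator B z)"
    proof (intro integral_mono int nB integrable_mult_right log_density_integrable)
      show "- (\<eta> / 2) * indicator B z \<le> TF_potential Y \<sigma> z * indicator B z" for z
        using far[of z] by (cases "z \<in> B") auto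
    qed
    then have "measure lborel A * (- (\<eta> / 2) * measure lborel B)
        \<le> measure lborel A * (LINT z|lborel. TF_potential Y \<sigma> z * indicator B z)"
      using log_density_integrable[OF nB] by (intro mult_left_mono) auto
    ultimately have "measure lborel A * (- (\<eta> / 2) * measure lborel B) \<le> measure lborel B * (- \<eta> * measure lborel A)"
      by linarith
    then have "measure lborel A * measure lborel B * (\<eta> / 2) \<le> 0" by (simp add: algebra_simps)
    then have "measure lborel A \<le> 0" using mB \<open>0 < \<eta>\<close> by (simp add: mult_le_0_iff)
    then have "measure lborel A = 0" using measure_nonneg[of lborel A] by linarith
    moreover have "emeasure lborel A \<noteq> \<infinity>" using emeasure_bounded_finite[OF bA] by auto
    ultimately have "A \<in> null_sets lborel"
      by (auto simp: null_sets_def measure_eq_emeasure_eq_ennreal emeasure_eq_ennreal_measure)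
    then have "AE z in lborel. z \<notin> A" by (rule AE_not_in)
    then show ?thesis by eventually_elim (auto simp: A_def)
  qed
  have "AE z in lborel. \<forall>n. z \<in> D \<longrightarrow> \<sigma> z < 1 / real (n + 2)"
    unfolding AE_all_countable using null by blast
  then show ?thesis
  proof eventually_elim
    case (elim z)
    show ?case
    proof
      assume "z \<in> D"
      have "\<sigma> z \<le> 0"
      proof (rule tendsto_lowerbound)
        show "(\<lambda>n. 1 / real (n + 2)) \<longlonglongrightarrow> 0" by real_asymp
        show "\<forall>\<^sub>F n in sequentially. \<sigma> z \<le> 1 / real (n + 2)"
          using elim \<open>z \<in> D\<close> by (intro always_eventually allI less_imp_le) auto
      qed simp
      then show "\<sigma> z = 0" using \<sigma>01(1)[of z] by simp
    qed
  qed
qed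

section \<open>Circle means of the full potential\<close>

lemma circle_mean_log_pot:
  assumes g: "log_density g" and "0 < r"
  shows "set_integrable lborel {0..2*pi} (\<lambda>t. log_pot g (circle_pt p r t))"
    and "(LINT t:{0..2*pi}|lborel. log_pot g (circle_pt p r t))
        = 2 * pi * (log_pot g p + (LINT w|lborel. g w * log_cut r (dist p w)))"
proof -
  note [measurable] = log_density_measurable[OF g]
  obtain C where C: "0 \<le> C" "\<And>z. (LINT w|lborel. \<bar>g w * ln (dist z w)\<bar>) \<le> C * ln (2 + norm z)"
    using log_density_ln_dist_bound[OF g] by blast
  define f where "f t w = indicator {0..2*pi} t * (g w * ln (dist (circle_pt p r t) w))" for t w
  have norm_circle_pt: "norm (circle_pt p r t) \<le> norm p + r" for t
    using norm_triangle_ineq[of p "circle_pt p r t - p"] dist_circle_pt_center[of p r t] \<open>0 < r\<close>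
    by (simp add: dist_norm)
  have pair: "integrable (lborel \<Otimes>\<^sub>M lborel) (\<lambda>(t, w). f t w)"
  proof (rule lborel_pair.Fubini_integrable)
    show "integrable lborel (\<lambda>t. LINT w|lborel. norm (case (t, w) of (t, w) \<Rightarrow> f t w))"
    proof (rule Bochner_Integration.integrable_bound)
      show "integrable lborel (\<lambda>t. indicator {0..2*pi} t * (C * ln (2 + norm p + r)))"
        by (intro integrable_mult_left integrable_real_indicator) auto
      show "AE t in lborel. norm (LINT w|lborel. norm (case (t, w) of (t, w) \<Rightarrow> f t w))
          \<le> norm (indicator {0..2*pi} t * (C * ln (2 + norm p + r)))"
      proof (rule AE_I2)
        fix t :: real
        have "(LINT w|lborel. norm (case (t, w) of (t, w) \<Rightarrow> f t w))
            = indicator {0..2*pi} t * (LINT w|lborel. \<bar>g w * ln (dist (circle_pt p r t) w)\<bar>)"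
          by (simp add: f_def abs_mult)
        also have "\<dots> \<le> indicator {0..2*pi} t * (C * ln (2 + norm (circle_pt p r t)))"
          by (intro mult_left_mono C) auto
        also have "\<dots> \<le> indicator {0..2*pi} t * (C * ln (2 + norm p + r))"
        proof -
          have "0 < 2 + norm (circle_pt p r t)" by (simp add: add_pos_nonneg)
          then have "ln (2 + norm (circle_pt p r t)) \<le> ln (2 + norm p + r)"
            using norm_circle_pt[of t] by (intro ln_mono) linarith+
          then show ?thesis using C(1) by (intro mult_left_mono) auto
        qed
        finally show "norm (LINT w|lborel. norm (case (t, w) of (t, w) \<Rightarrow> f t w))
          \<le> norm (indicator {0..2*pi} t * (C * ln (2 + norm p + r)))"
          by simp
      qed
    qed (unfold f_def, measurable)
    show "AE t in lborel. integrable lborel (\<lambda>w. case (t, w) of (t, w) \<Rightarrow> f t w)"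
      using log_density_ln_dist_integrable[OF g] by (simp add: f_def)
  qed (unfold f_def, measurable)
  have f_log_pot: "(LINT w|lborel. f t w) = indicator {0..2*pi} t *\<^sub>R log_pot g (circle_pt p r t)" for t
    by (simp add: f_def log_pot_def)
  show "set_integrable lborel {0..2*pi} (\<lambda>t. log_pot g (circle_pt p r t))"
    using lborel_pair.integrable_fst'[OF pair] unfolding set_integrable_def by (simp add: f_log_pot)
  have "(LINT t:{0..2*pi}|lborel. log_pot g (circle_pt p r t)) = (LINT t|lborel. LINT w|lborel. f t w)"
    by (simp add: set_lebesgue_integral_def f_log_pot)
  also have "\<dots> = (LINT w|lborel. LINT t|lborel. f t w)"
    by (rule lborel_pair.Fubini_integral[symmetric, OF pair])
  also have "\<dots> = (LINT w|lborel. 2 * pi * (g w * ln (max r (dist p w))))"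
  proof (rule integral_cong_AE)
    \<comment> \<open>Newton's theorem is available for \<open>w\<close> off the circle, hence for
      almost every \<open>w\<close>.\<close>
    have "sphere p r \<in> null_sets lborel"
      using negligible_sphere[of p r]
      by (auto simp: null_sets_completion_iff negligible_iff_null_sets negligible_convex_frontier)
    then have "AE w in lborel. w \<notin> sphere p r"
      by (rule AE_not_in)
    then have "AE w in lborel. dist p w \<noteq> r"
      by eventually_elim auto
    then show "AE w in lborel. (LINT t|lborel. f t w) = 2 * pi * (g w * ln (max r (dist p w)))"
    proof eventually_elim
      case (elim w)
      have "(LINT t|lborel. f t w) = g w * (LINT t:{0..2*pi}|lborel. ln (dist (circle_pt p r t) w))"
        by (simp add: f_def set_lebesgue_integral_def mult.left_commute[of "indicator _ _"])
      then show ?case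
        using circle_mean_ln(2)[OF \<open>0 < r\<close> elim] by simp
    qed
  qed (unfold f_def, measurable)
  also have "\<dots> = 2 * pi * (LINT w|lborel. g w * ln (max r (dist p w)))"
    by simp
  also have "(LINT w|lborel. g w * ln (max r (dist p w))) = log_pot g p + (LINT w|lborel. g w * log_cut r (dist p w))"
    by (rule log_pot_split[OF g \<open>0 < r\<close>])
  finally show "(LINT t:{0..2*pi}|lborel. log_pot g (circle_pt p r t))
        = 2 * pi * (log_pot g p + (LINT w|lborel. g w * log_cut r (dist p w)))" .
qed

text \<open>A formula of Jensen type: circle mean minus central value is the charge in the disc
  tested against \<open>log_cut r\<close>, with a minus sign for the nuclei and a plus sign for the
  density.\<close>

lemma circle_mean_TF_potential:
  assumes \<sigma>: "log_density \<sigma>" and "finite Y" and "0 < r" and "p \<notin> Y" and ne: "\<And>y. y \<in> Y \<Longrightarrow> dist p y \<noteq> r"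
  shows "set_integrable lborel {0..2*pi} (\<lambda>t. TF_potential Y \<sigma> (circle_pt p r t))"
    and "(LINT t:{0..2*pi}|lborel. TF_potential Y \<sigma> (circle_pt p r t))
        = 2 * pi * (TF_potential Y \<sigma> p - (\<Sum>y\<in>Y. log_cut r (dist p y))
            + (LINT w|lborel. \<sigma> w * log_cut r (dist p w)))"
proof -
  note V = circle_mean_ln[OF \<open>0 < r\<close> ne] and P = circle_mean_log_pot[OF \<sigma> \<open>0 < r\<close>, of p]
  have iV: "set_integrable lborel {0..2*pi} (\<lambda>t. \<Sum>y\<in>Y. ln (dist (circle_pt p r t) y))"
    using V(1) unfolding set_integrable_def scaleR_sum_right by (rule Bochner_Integration.integrable_sum)
  have eq: "TF_potential Y \<sigma> (circle_pt p r t) = log_pot \<sigma> (circle_pt p r t) - (\<Sum>y\<in>Y. ln (dist (circle_pt p r t) y))" for t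
    by (simp add: TF_potential_eq V_nuc_def)
  show "set_integrable lborel {0..2*pi} (\<lambda>t. TF_potential Y \<sigma> (circle_pt p r t))"
    unfolding eq by (rule set_integral_diff[OF P(1) iV])
  have "(LINT t:{0..2*pi}|lborel. \<Sum>y\<in>Y. ln (dist (circle_pt p r t) y))
      = (\<Sum>y\<in>Y. LINT t:{0..2*pi}|lborel. ln (dist (circle_pt p r t) y))"
    unfolding set_lebesgue_integral_def scaleR_sum_right
    by (rule Bochner_Integration.integral_sum) (use V(1) in \<open>simp add: set_integrable_def\<close>)
  also have "\<dots> = (\<Sum>y\<in>Y. 2 * pi * (ln (dist p y) + log_cut r (dist p y)))"
  proof (rule sum.cong)
    fix y assume "y \<in> Y"
    then have "ln (max r (dist p y)) = ln (dist p y) + log_cut r (dist p y)"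
      using \<open>p \<notin> Y\<close> by (intro ln_max_eq \<open>0 < r\<close>) auto
    then show "(LINT t:{0..2*pi}|lborel. ln (dist (circle_pt p r t) y)) = 2 * pi * (ln (dist p y) + log_cut r (dist p y))"
      using V(2)[OF \<open>y \<in> Y\<close>] by simp
  qed simp
  also have "\<dots> = 2 * pi * ((\<Sum>y\<in>Y. ln (dist p y)) + (\<Sum>y\<in>Y. log_cut r (dist p y)))"
    by (simp add: sum_distrib_left sum.distrib algebra_simps)
  finally show "(LINT t:{0..2*pi}|lborel. TF_potential Y \<sigma> (circle_pt p r t))
        = 2 * pi * (TF_potential Y \<sigma> p - (\<Sum>y\<in>Y. log_cut r (dist p y))
            + (LINT w|lborel. \<sigma> w * log_cut r (dist p w)))"
    unfolding eq set_integral_diff(2)[OF P(1) iV] P(2)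
    by (simp add: TF_potential_eq V_nuc_def algebra_simps)
qed

section \<open>Positivity of the potential and the exclusion rule\<close>

text \<open>Minimum principle. A negative value would yield a negative global minimum off the
  nuclei; around it the density is zero, so means over small circles equal the minimum and the
  potential is constant on them. The statement is restricted to points off \<open>Y\<close> because
  \<open>ln 0 = 0\<close> makes the formal value at a nucleus meaningless.\<close>

lemma TF_potential_nonneg:
  assumes min: "TF_minimizer Y \<sigma>" and "finite Y" and "z0 \<notin> Y"
  shows "0 \<le> TF_potential Y \<sigma> z0"
proof (rule ccontr)
  have \<sigma>: "TF_admissible Y \<sigma>" using min by (simp add: TF_minimizer_def)
  note n\<sigma> = TF_admissible_log_density[OF \<sigma>]
  have \<sigma>01: "\<And>z. 0 \<le> \<sigma> z" "\<And>z. \<sigma> z \<le> 1" using \<sigma> by (auto simp: TF_admissible_def)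
  assume "\<not> 0 \<le> TF_potential Y \<sigma> z0"
  \<comment> \<open>Half the depth at \<open>z0\<close>: beyond radius \<open>\<rho>\<close> the
    potential stays above its value at \<open>z0\<close>, so the minimum is sought in a compact
    disc.\<close>
  define \<eta> where "\<eta> = - TF_potential Y \<sigma> z0 / 2"
  have "0 < \<eta>" using \<open>\<not> 0 \<le> TF_potential Y \<sigma> z0\<close> by (simp add: \<eta>_def)
  \<comment> \<open>\<open>Q\<close> equals \<open>exp (- \<Phi>)\<close> off \<open>Y\<close>, but is continuous on the whole plane.\<close>
  define Q where "Q z = (\<Prod>y\<in>Y. dist z y) * exp (- log_pot \<sigma> z)" for z
  have contQ: "continuous_on UNIV Q"
    unfolding Q_def using continuous_log_pot[OF n\<sigma> \<sigma>01] by (auto intro!: continuous_intros)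
  have Q0: "Q z = 0" if "z \<in> Y" for z
    using that \<open>finite Y\<close> by (auto simp: Q_def)
  have Qexp: "Q z = exp (- TF_potential Y \<sigma> z)" if "z \<notin> Y" for z
  proof -
    have "exp (\<Sum>y\<in>Y. ln (dist z y)) = (\<Prod>y\<in>Y. dist z y)"
      unfolding exp_sum[OF \<open>finite Y\<close>] using that by (intro prod.cong) auto
    then show ?thesis
      by (simp add: Q_def TF_potential_eq V_nuc_def exp_diff exp_minus field_simps)
  qed
  obtain \<rho> where \<rho>: "\<And>z. \<rho> \<le> norm z \<Longrightarrow> - \<eta> \<le> TF_potential Y \<sigma> z"
    using TF_potential_at_infinity[OF \<sigma> \<open>finite Y\<close> \<open>0 < \<eta>\<close>] by auto
  have out: "Q z < Q z0" if "\<rho> \<le> norm z" for z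
  proof (cases "z \<in> Y")
    case True
    then show ?thesis by (simp add: Q0 Qexp \<open>z0 \<notin> Y\<close>)
  next
    case False
    have "TF_potential Y \<sigma> z0 < TF_potential Y \<sigma> z"
      using \<rho>[OF that] \<open>0 < \<eta>\<close> by (simp add: \<eta>_def)
    then show ?thesis using False by (simp add: Qexp \<open>z0 \<notin> Y\<close>)
  qed
  have "z0 \<in> cball 0 \<rho>" using out[of z0] by (cases "\<rho> \<le> norm z0") auto
  then obtain p0 where p0: "p0 \<in> cball 0 \<rho>" "\<And>z. z \<in> cball 0 \<rho> \<Longrightarrow> Q z \<le> Q p0"
    using continuous_attains_sup[OF compact_cball _ continuous_on_subset[OF contQ subset_UNIV], of 0 \<rho>]
    by blast
  have max: "Q z \<le> Q p0" for z
  proof (cases "\<rho> \<le> norm z")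
    case True
    then show ?thesis using out[of z] p0(2)[OF \<open>z0 \<in> cball 0 \<rho>\<close>] by simp
  next
    case False
    then show ?thesis by (intro p0(2)) simp
  qed
  \<comment> \<open>Among the minimizers of \<open>\<Phi>\<close> take one with maximal first coordinate; the circle mean then forces
    a minimizer further to the right.\<close>
  define S where "S = {z. Q z = Q p0}"
  have "closed S"
    unfolding S_def by (intro closed_Collect_eq contQ continuous_intros)
  moreover have "S \<subseteq> cball 0 \<rho>"
  proof
    fix z assume "z \<in> S"
    then have "\<not> Q z < Q z0" using max[of z0] by (simp add: S_def not_less)
    then show "z \<in> cball 0 \<rho>" using out[of z] by (cases "\<rho> \<le> norm z") auto
  qed
  ultimately have "compact S"
    by (meson bounded_cball bounded_subset compact_eq_bounded_closed)
  moreover have "p0 \<in> S" by (simp add: S_def)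
  moreover have "continuous_on S (\<lambda>z. z $ 1)" by (intro continuous_intros)
  ultimately obtain p :: pt where p: "p \<in> S" "\<And>z. z \<in> S \<Longrightarrow> z $ 1 \<le> p $ 1"
    using continuous_attains_sup[of S "\<lambda>z::pt. z $ 1"] by blast
  define m where "m = - TF_potential Y \<sigma> p"
  have "0 < Q z0" using \<open>z0 \<notin> Y\<close> by (simp add: Qexp)
  then have "0 < Q p" using max[of z0] p(1) by (simp add: S_def)
  then have "p \<notin> Y" using Q0 by fastforce
  have Qp: "Q p = exp m" using Qexp[OF \<open>p \<notin> Y\<close>] by (simp add: m_def)
  have "Q z0 \<le> Q p" using max p(1) by (simp add: S_def)
  then have "0 < m" using Qexp[OF \<open>z0 \<notin> Y\<close>] \<open>0 < \<eta>\<close> by (simp add: Qp \<eta>_def)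
  have pmin: "- m \<le> TF_potential Y \<sigma> z" if "z \<notin> Y" for z
  proof -
    have "Q z \<le> Q p" using max[of z] p(1) by (simp add: S_def)
    then have "exp (- TF_potential Y \<sigma> z) \<le> exp m" by (simp only: Qp Qexp[OF that])
    then show ?thesis by simp
  qed
  \<comment> \<open>On a small disc around \<open>p\<close> the potential is below
    \<open>- m / 2\<close>. Such a disc contains no nucleus, as \<open>Q\<close> vanishes at the
    nuclei, and the density is null on it.\<close>
  have "open {z. exp (m / 2) < Q z}"
    by (intro open_Collect_less contQ continuous_intros)
  moreover have "p \<in> {z. exp (m / 2) < Q z}" using \<open>0 < m\<close> by (simp add: Qp)
  ultimately obtain s where s: "0 < s" "ball p s \<subseteq> {z. exp (m / 2) < Q z}"
    by (meson openE)
  have ballY: "z \<notin> Y" if "z \<in> ball p s" for z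
  proof
    assume "z \<in> Y"
    then have "Q z = 0" by (rule Q0)
    moreover have "exp (m / 2) < Q z" using s(2) that by blast
    ultimately show False using exp_gt_zero[of "m/2"] by linarith
  qed
  have neg: "TF_potential Y \<sigma> z \<le> - (m / 2)" if "z \<in> ball p s" for z
  proof -
    have "exp (m / 2) < Q z" using s(2) that by blast
    then show ?thesis using Qexp[OF ballY[OF that]] by simp
  qed
  have vanish: "AE z in lborel. z \<in> ball p s \<longrightarrow> \<sigma> z = 0"
    by (rule TF_minimizer_vanishes[OF min \<open>finite Y\<close>, of "m / 2"]) (use neg \<open>0 < m\<close> in auto)
  define r where "r = s / 2"
  have r: "0 < r" "r < s" using s by (auto simp: r_def)
  have in_ball: "circle_pt p r t \<in> ball p s" for t
    using dist_circle_pt_center[of p r t] r by (simp add: dist_commute)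
  have far: "s \<le> dist p y" if "y \<in> Y" for y
    using ballY[of y] that by (auto simp: not_less[symmetric])
  have mean: "set_integrable lborel {0..2*pi} (\<lambda>t. TF_potential Y \<sigma> (circle_pt p r t))"
    "(LINT t:{0..2*pi}|lborel. TF_potential Y \<sigma> (circle_pt p r t))
        = 2 * pi * (TF_potential Y \<sigma> p - (\<Sum>y\<in>Y. log_cut r (dist p y))
            + (LINT w|lborel. \<sigma> w * log_cut r (dist p w)))"
    using far r by (intro circle_mean_TF_potential[OF n\<sigma> \<open>finite Y\<close> r(1) \<open>p \<notin> Y\<close>]; force)+
  have "(\<Sum>y\<in>Y. log_cut r (dist p y)) = 0"
    using far r by (intro sum.neutral ballI log_cut_eq_0) force+
  moreover have "(LINT w|lborel. \<sigma> w * log_cut r (dist p w)) = 0"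
  proof (rule integral_eq_zero_AE)
    show "AE w in lborel. \<sigma> w * log_cut r (dist p w) = 0"
      using vanish
    proof eventually_elim
      case (elim w)
      then show ?case using r by (cases "w \<in> ball p s") (auto intro!: log_cut_eq_0)
    qed
  qed
  ultimately have mean_m: "(LINT t:{0..2*pi}|lborel. TF_potential Y \<sigma> (circle_pt p r t)) = 2 * pi * (- m)"
    using mean(2) by (simp add: m_def)
  have eq: "TF_potential Y \<sigma> (circle_pt p r t) = - ln (Q (circle_pt p r t))" for t
    using Qexp[OF ballY[OF in_ball[of t]]] by simp
  have "continuous_on {0..2*pi} (\<lambda>t. Q (circle_pt p r t))"
    by (rule continuous_on_compose2[OF contQ continuous_on_circle_pt]) simp
  moreover have "Q (circle_pt p r t) \<noteq> 0" for t
    using Qexp[OF ballY[OF in_ball[of t]]] by simp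
  ultimately have cont: "continuous_on {0..2*pi} (\<lambda>t. TF_potential Y \<sigma> (circle_pt p r t))"
    unfolding eq by (intro continuous_intros) auto
  have "((\<lambda>t. TF_potential Y \<sigma> (circle_pt p r t)) has_integral 2 * pi * (- m)) {0..2*pi}"
    using set_borel_integral_eq_integral[OF mean(1)] mean_m by (simp add: has_integral_integrable_integral)
  moreover have "((\<lambda>t::real. - m) has_integral 2 * pi * (- m)) {0..2*pi}"
    using has_integral_const_real[of "- m" 0 "2 * pi"] by simp
  ultimately have "((\<lambda>t. TF_potential Y \<sigma> (circle_pt p r t) - (- m)) has_integral 2 * pi * (- m) - 2 * pi * (- m)) {0..2*pi}"
    by (rule has_integral_diff)
  then have "integral {0..2*pi} (\<lambda>t. TF_potential Y \<sigma> (circle_pt p r t) - (- m)) = 0"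
    by (simp add: integral_unique)
  moreover have "continuous_on {0..2*pi} (\<lambda>t. TF_potential Y \<sigma> (circle_pt p r t) - (- m))"
    by (intro continuous_intros cont)
  moreover have "0 \<le> TF_potential Y \<sigma> (circle_pt p r t) - (- m)" for t
    using pmin[OF ballY[OF in_ball[of t]]] by simp
  \<comment> \<open>A continuous nonnegative function with zero integral vanishes everywhere; angle
    0 then gives the point of the circle furthest to the right.\<close>
  ultimately have "\<forall>t\<in>{0..2*pi}. TF_potential Y \<sigma> (circle_pt p r t) - (- m) = 0"
    by (subst (asm) integral_eq_0_iff) auto
  then have "TF_potential Y \<sigma> (circle_pt p r 0) - (- m) = 0" by (rule bspec) simp
  then have "TF_potential Y \<sigma> (circle_pt p r 0) = - m" by simp
  then have "Q (circle_pt p r 0) = Q p" using Qexp[OF ballY[OF in_ball[of 0]]] Qp by simp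
  then have "circle_pt p r 0 \<in> S" using p(1) by (simp add: S_def)
  then have "(circle_pt p r 0) $ 1 \<le> p $ 1" by (rule p(2))
  then show False using r(1) by (simp add: circle_pt_0 axis_def)
qed

lemma log_cut_sum_le_generic:
  assumes min: "TF_minimizer Y \<sigma>" and "finite Y" and "x \<notin> Y" and "TF_potential Y \<sigma> x \<le> 0"
    and "0 < r" and ne: "\<And>y. y \<in> Y \<Longrightarrow> dist x y \<noteq> r"
  shows "(\<Sum>y\<in>Y. log_cut r (dist x y)) \<le> pi * r\<^sup>2 / 2"
proof -
  have \<sigma>: "TF_admissible Y \<sigma>" using min by (simp add: TF_minimizer_def)
  note n\<sigma> = TF_admissible_log_density[OF \<sigma>]
  have \<sigma>01: "\<And>z. 0 \<le> \<sigma> z" "\<And>z. \<sigma> z \<le> 1" using \<sigma> by (auto simp: TF_admissible_def)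
  have "circle_pt x r t \<notin> Y" for t
    using ne[of "circle_pt x r t"] dist_circle_pt_center[of x r t] \<open>0 < r\<close> by (auto simp: dist_commute)
  then have "0 \<le> (LINT t:{0..2*pi}|lborel. TF_potential Y \<sigma> (circle_pt x r t))"
    unfolding set_lebesgue_integral_def
    by (intro Bochner_Integration.integral_nonneg) (auto intro!: mult_nonneg_nonneg TF_potential_nonneg[OF min \<open>finite Y\<close>])
  also have "\<dots> = 2 * pi * (TF_potential Y \<sigma> x - (\<Sum>y\<in>Y. log_cut r (dist x y))
            + (LINT w|lborel. \<sigma> w * log_cut r (dist x w)))"
    by (rule circle_mean_TF_potential[OF n\<sigma> \<open>finite Y\<close> \<open>0 < r\<close> \<open>x \<notin> Y\<close> ne])
  finally have "0 \<le> TF_potential Y \<sigma> x - (\<Sum>y\<in>Y. log_cut r (dist x y))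
            + (LINT w|lborel. \<sigma> w * log_cut r (dist x w))"
    using pi_gt_zero by (auto simp: zero_le_mult_iff)
  then show ?thesis
    using density_log_cut_bounds(2)[OF n\<sigma> \<sigma>01 \<open>0 < r\<close>, of x] assms(4) by linarith
qed

text \<open>The bound is known for radii at which no nucleus lies on the circle. The exceptional
  radii are finitely many and both sides are continuous in \<open>r\<close>, so it extends to all
  \<open>r > 0\<close>.\<close>

lemma exclusion_rule_log_cut_sum_le:
  assumes X: "exclusion_rule X" "finite X" "x \<in> X" and "0 < r"
  shows "(\<Sum>y\<in>X - {x}. log_cut r (dist x y)) \<le> pi * r\<^sup>2 / 2"
proof (cases "X - {x} = {}")
  case True
  show ?thesis unfolding True by simp
next
  case False
  define Y where "Y = X - {x}"
  have Y: "finite Y" "x \<notin> Y" using X by (auto simp: Y_def)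
  have "x \<notin> screening_set Y"
    using X(1,3) False unfolding exclusion_rule_def Y_def by blast
  \<comment> \<open>The screening set quantifies over all minimizers, so a point outside it supplies
    one.\<close>
  then obtain \<sigma> where \<sigma>: "TF_minimizer Y \<sigma>" "TF_potential Y \<sigma> x \<le> 0"
    by (auto simp: screening_set_def not_less)
  have "(\<Sum>y\<in>Y. log_cut r (dist x y)) \<le> pi * r\<^sup>2 / 2"
  proof (rule tendsto_le)
    show "((\<lambda>r. pi * r\<^sup>2 / 2) \<longlongrightarrow> pi * r\<^sup>2 / 2) (at r)"
      by (intro tendsto_intros) auto
    show "((\<lambda>r. \<Sum>y\<in>Y. log_cut r (dist x y)) \<longlongrightarrow> (\<Sum>y\<in>Y. log_cut r (dist x y))) (at r)"
      unfolding log_cut_def using Y \<open>0 < r\<close> by (intro tendsto_intros) auto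
    have "\<forall>\<^sub>F r' in at r. \<forall>y\<in>Y. r' \<noteq> dist x y"
      using Y(1) by (intro eventually_ball_finite ballI eventually_neq_at_within)
    moreover have "\<forall>\<^sub>F r' in at r. 0 < r'"
      using order_tendstoD(1)[OF tendsto_ident_at \<open>0 < r\<close>, of UNIV] .
    ultimately show "\<forall>\<^sub>F r' in at r. (\<Sum>y\<in>Y. log_cut r' (dist x y)) \<le> pi * r'\<^sup>2 / 2"
    proof eventually_elim
      case (elim r')
      then show ?case
        by (intro log_cut_sum_le_generic[OF \<sigma>(1) Y \<sigma>(2)]) auto
    qed
  qed simp
  then show ?thesis by (simp add: Y_def)
qed

section \<open>Gaussian sums\<close>

lemma dist_parallelogram:
  fixes x y b :: pt
  shows "(dist x b)\<^sup>2 + (dist y b)\<^sup>2 = 2 * (dist ((1/2) *\<^sub>R (x + y)) b)\<^sup>2 + (dist x y)\<^sup>2 / 2"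
proof -
  have "(1/2) *\<^sub>R (x + y) - b = (1/2) *\<^sub>R ((x - b) + (y - b))"
    by (simp add: vec_eq_iff field_simps)
  then have "(dist ((1/2) *\<^sub>R (x + y)) b)\<^sup>2 = (norm ((x - b) + (y - b)))\<^sup>2 / 4"
    by (simp only: dist_norm norm_scaleR) (simp add: power_divide)
  moreover have "(norm ((x - b) + (y - b)))\<^sup>2 + (norm ((x - b) - (y - b)))\<^sup>2
      = 2 * ((norm (x - b))\<^sup>2 + (norm (y - b))\<^sup>2)"
    unfolding power2_norm_eq_inner inner_add_left inner_add_right inner_diff_left inner_diff_right
    by (simp add: algebra_simps inner_commute)
  ultimately show ?thesis
    by (simp add: dist_norm)
qed

text \<open>Positive definiteness in concrete form: the Gaussian of width \<open>s\<close> is, up to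
  a constant, the convolution of a narrower Gaussian with itself. Completing the square about the
  midpoint of \<open>x\<close> and \<open>y\<close> separates the factors.\<close>

lemma gauss_product_integral:
  fixes x y :: pt
  assumes "0 < s"
  shows "integrable lborel (\<lambda>b. exp (- 2 / s\<^sup>2 * (dist x b)\<^sup>2) * exp (- 2 / s\<^sup>2 * (dist y b)\<^sup>2))"
    and "(LINT b|lborel. exp (- 2 / s\<^sup>2 * (dist x b)\<^sup>2) * exp (- 2 / s\<^sup>2 * (dist y b)\<^sup>2))
       = pi * s\<^sup>2 / 4 * exp (- (dist x y)\<^sup>2 / s\<^sup>2)"
proof -
  have eq: "exp (- 2 / s\<^sup>2 * (dist x b)\<^sup>2) * exp (- 2 / s\<^sup>2 * (dist y b)\<^sup>2)
     = exp (- (dist x y)\<^sup>2 / s\<^sup>2) * exp (- (4 / s\<^sup>2) * (dist ((1/2) *\<^sub>R (x + y)) b)\<^sup>2)" for b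
  proof -
    have "- 2 / s\<^sup>2 * (dist x b)\<^sup>2 + - 2 / s\<^sup>2 * (dist y b)\<^sup>2 = - 2 / s\<^sup>2 * ((dist x b)\<^sup>2 + (dist y b)\<^sup>2)"
      by (simp only: distrib_left)
    also have "\<dots> = - (dist x y)\<^sup>2 / s\<^sup>2 + - (4 / s\<^sup>2) * (dist ((1/2) *\<^sub>R (x + y)) b)\<^sup>2"
      unfolding dist_parallelogram using assms by (simp add: field_simps)
    finally show ?thesis by (simp only: exp_add[symmetric])
  qed
  have "0 < 4 / s\<^sup>2" using assms by simp
  note G = integral_gauss[OF this, of "(1/2) *\<^sub>R (x + y)"]
  show "integrable lborel (\<lambda>b. exp (- 2 / s\<^sup>2 * (dist x b)\<^sup>2) * exp (- 2 / s\<^sup>2 * (dist y b)\<^sup>2))"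
    unfolding eq by (intro integrable_mult_right G)
  show "(LINT b|lborel. exp (- 2 / s\<^sup>2 * (dist x b)\<^sup>2) * exp (- 2 / s\<^sup>2 * (dist y b)\<^sup>2))
       = pi * s\<^sup>2 / 4 * exp (- (dist x y)\<^sup>2 / s\<^sup>2)"
    unfolding eq using G by simp
qed

text \<open>Outside the enlarged disc \<open>b\<close> is at distance at least \<open>l\<close> from
  \<open>x\<close>, so half of the exponent yields the factor \<open>exp (- l^2 / s^2)\<close>. The
  Gaussian left over has twice the original mass, which explains the 2.\<close>

lemma gauss_mass_in_ball:
  fixes x a :: pt
  assumes "0 < s" "0 \<le> l" "x \<in> ball a R"
  shows "pi * s\<^sup>2 / 2 * (1 - 2 * exp (- l\<^sup>2 / s\<^sup>2))
     \<le> (LINT b|lborel. exp (- 2 / s\<^sup>2 * (dist x b)\<^sup>2) * indicator (ball a (R + l)) b)"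
proof -
  have c: "0 < 2 / s\<^sup>2" "0 < 1 / s\<^sup>2" using assms by auto
  note G2 = integral_gauss[OF c(1), of x, simplified] and G1 = integral_gauss[OF c(2), of x, simplified]
  have "(LINT b|lborel. exp (- 2 / s\<^sup>2 * (dist x b)\<^sup>2) - exp (- l\<^sup>2 / s\<^sup>2) * exp (- (1 / s\<^sup>2) * (dist x b)\<^sup>2))
     \<le> (LINT b|lborel. exp (- 2 / s\<^sup>2 * (dist x b)\<^sup>2) * indicator (ball a (R + l)) b)"
  proof (rule integral_mono)
    show "integrable lborel (\<lambda>b. exp (- 2 / s\<^sup>2 * (dist x b)\<^sup>2) - exp (- l\<^sup>2 / s\<^sup>2) * exp (- (1 / s\<^sup>2) * (dist x b)\<^sup>2))"
      using G1 G2 by simp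
    show "integrable lborel (\<lambda>b. exp (- 2 / s\<^sup>2 * (dist x b)\<^sup>2) * indicator (ball a (R + l)) b)"
      using G2(1) by (intro integrable_real_mult_indicator) auto
    show "exp (- 2 / s\<^sup>2 * (dist x b)\<^sup>2) - exp (- l\<^sup>2 / s\<^sup>2) * exp (- (1 / s\<^sup>2) * (dist x b)\<^sup>2)
        \<le> exp (- 2 / s\<^sup>2 * (dist x b)\<^sup>2) * indicator (ball a (R + l)) b" for b
    proof (cases "b \<in> ball a (R + l)")
      case False
      have "l \<le> dist x b"
        using False assms(3) dist_triangle[of a b x] by simp
      then have "l\<^sup>2 \<le> (dist x b)\<^sup>2" using assms(2) by (intro power_mono)
      then have "- 2 / s\<^sup>2 * (dist x b)\<^sup>2 \<le> - l\<^sup>2 / s\<^sup>2 + - (1 / s\<^sup>2) * (dist x b)\<^sup>2"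
        using assms(1) by (simp add: field_simps)
      then have "exp (- 2 / s\<^sup>2 * (dist x b)\<^sup>2) \<le> exp (- l\<^sup>2 / s\<^sup>2) * exp (- (1 / s\<^sup>2) * (dist x b)\<^sup>2)"
        unfolding exp_add[symmetric] by (simp only: exp_le_cancel_iff)
      then show ?thesis using False by simp
    qed simp
  qed
  moreover have "(LINT b|lborel. exp (- 2 / s\<^sup>2 * (dist x b)\<^sup>2) - exp (- l\<^sup>2 / s\<^sup>2) * exp (- (1 / s\<^sup>2) * (dist x b)\<^sup>2))
     = pi * s\<^sup>2 / 2 * (1 - 2 * exp (- l\<^sup>2 / s\<^sup>2))"
    using G1 G2 by (simp add: algebra_simps)
  ultimately show ?thesis by simp
qed

text \<open>Cauchy-Schwarz between \<open>h\<close> and the indicator \<open>I\<close> of the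
  enlarged disc, carried out by expanding the nonnegative integral of
  \<open>(h - k * I)^2\<close>.\<close>

lemma gauss_energy_ge:
  fixes X :: "pt set"
  assumes "finite X" "X \<subseteq> ball a R" "0 < s" "0 \<le> l" "0 < R"
    and c: "0 \<le> c" "c \<le> 1 - 2 * exp (- l\<^sup>2 / s\<^sup>2)"
  shows "(real (card X))\<^sup>2 * s\<^sup>2 * c\<^sup>2 / (R + l)\<^sup>2 \<le> (\<Sum>x\<in>X. \<Sum>y\<in>X. exp (- (dist x y)\<^sup>2 / s\<^sup>2))"
proof -
  define N where "N = real (card X)"
  define g where "g x b = exp (- 2 / s\<^sup>2 * (dist x b)\<^sup>2)" for x b :: pt
  define h where "h b = (\<Sum>x\<in>X. g x b)" for b
  define I where "I b = (indicator (ball a (R + l)) b :: real)" for b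
  \<comment> \<open>The mean of \<open>h\<close> over the enlarged disc, its mass there replaced by
    the lower bound \<open>N * (pi * s^2 / 2 * c)\<close>.\<close>
  define k where "k = N * s\<^sup>2 * c / (2 * (R + l)\<^sup>2)"
  define E where "E = (\<Sum>x\<in>X. \<Sum>y\<in>X. exp (- (dist x y)\<^sup>2 / s\<^sup>2))"
  have Rl: "0 < R + l" using assms by simp
  have k0: "0 \<le> k" using c by (simp add: k_def N_def)
  have igg: "integrable lborel (\<lambda>b. g x b * g y b)" for x y
    unfolding g_def by (rule gauss_product_integral[OF \<open>0 < s\<close>])
  have ig: "integrable lborel (g x)" for x
    unfolding g_def using integral_gauss(1)[of "2 / s\<^sup>2" x] \<open>0 < s\<close> by simp
  have igI: "integrable lborel (\<lambda>b. g x b * I b)" for x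
    unfolding I_def by (intro integrable_real_mult_indicator ig) auto
  have iI: "integrable lborel I"
    using log_density_integrable[OF log_density_indicator[of "ball a (R + l)"]] by (simp add: I_def[abs_def])
  have sq: "(h b - k * I b)\<^sup>2 = (\<Sum>x\<in>X. \<Sum>y\<in>X. g x b * g y b) - 2 * k * (\<Sum>x\<in>X. g x b * I b) + k\<^sup>2 * I b" for b
  proof -
    have "I b * I b = I b" by (simp add: I_def indicator_def)
    then have "(h b - k * I b)\<^sup>2 = h b * h b - 2 * k * (h b * I b) + k\<^sup>2 * I b"
      by (simp add: power2_eq_square algebra_simps)
    moreover have "h b * h b = (\<Sum>x\<in>X. \<Sum>y\<in>X. g x b * g y b)"
      unfolding h_def by (rule sum_product)
    moreover have "h b * I b = (\<Sum>x\<in>X. g x b * I b)"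
      unfolding h_def by (rule sum_distrib_right)
    ultimately show ?thesis by simp
  qed
  have "0 \<le> (LINT b|lborel. (h b - k * I b)\<^sup>2)" by simp
  also have "\<dots> = (LINT b|lborel. (\<Sum>x\<in>X. \<Sum>y\<in>X. g x b * g y b))
      - 2 * k * (LINT b|lborel. (\<Sum>x\<in>X. g x b * I b)) + k\<^sup>2 * (LINT b|lborel. I b)"
  proof -
    have "integrable lborel (\<lambda>b. \<Sum>x\<in>X. \<Sum>y\<in>X. g x b * g y b)" "integrable lborel (\<lambda>b. \<Sum>x\<in>X. g x b * I b)"
      by (intro Bochner_Integration.integrable_sum igg igI)+
    then show ?thesis unfolding sq using iI by simp
  qed
  also have "(LINT b|lborel. (\<Sum>x\<in>X. \<Sum>y\<in>X. g x b * g y b)) = (\<Sum>x\<in>X. \<Sum>y\<in>X. LINT b|lborel. g x b * g y b)"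
    by (simp add: Bochner_Integration.integral_sum Bochner_Integration.integrable_sum igg)
  also have "(LINT b|lborel. (\<Sum>x\<in>X. g x b * I b)) = (\<Sum>x\<in>X. LINT b|lborel. g x b * I b)"
    by (rule Bochner_Integration.integral_sum) (rule igI)
  also have "(\<Sum>x\<in>X. \<Sum>y\<in>X. LINT b|lborel. g x b * g y b) = pi * s\<^sup>2 / 4 * E"
    unfolding g_def gauss_product_integral(2)[OF \<open>0 < s\<close>] E_def by (simp add: sum_distrib_left)
  also have "(LINT b|lborel. I b) = pi * (R + l)\<^sup>2"
    using Rl by (simp add: I_def content_ball unit_ball_vol_2)
  finally have 1: "2 * k * (\<Sum>x\<in>X. LINT b|lborel. g x b * I b) \<le> pi * s\<^sup>2 / 4 * E + k\<^sup>2 * (pi * (R + l)\<^sup>2)"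
    by simp
  have "N * (pi * s\<^sup>2 / 2 * c) = (\<Sum>x\<in>X. pi * s\<^sup>2 / 2 * c)" by (simp add: N_def)
  also have "\<dots> \<le> (\<Sum>x\<in>X. LINT b|lborel. g x b * I b)"
  proof (rule sum_mono)
    fix x assume "x \<in> X"
    have "pi * s\<^sup>2 / 2 * c \<le> pi * s\<^sup>2 / 2 * (1 - 2 * exp (- l\<^sup>2 / s\<^sup>2))"
      by (intro mult_left_mono c) simp
    also have "\<dots> \<le> (LINT b|lborel. g x b * I b)"
      unfolding g_def I_def by (rule gauss_mass_in_ball) (use assms \<open>x \<in> X\<close> in auto)
    finally show "pi * s\<^sup>2 / 2 * c \<le> (LINT b|lborel. g x b * I b)" .
  qed
  finally have "2 * k * (N * (pi * s\<^sup>2 / 2 * c)) \<le> 2 * k * (\<Sum>x\<in>X. LINT b|lborel. g x b * I b)"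
    using k0 by (intro mult_left_mono) auto
  with 1 have "2 * k * (N * (pi * s\<^sup>2 / 2 * c)) - k\<^sup>2 * (pi * (R + l)\<^sup>2) \<le> pi * s\<^sup>2 / 4 * E" by linarith
  also have "2 * k * (N * (pi * s\<^sup>2 / 2 * c)) - k\<^sup>2 * (pi * (R + l)\<^sup>2) = pi * s\<^sup>2 / 4 * (N\<^sup>2 * s\<^sup>2 * c\<^sup>2 / (R + l)\<^sup>2)"
  proof -
    define D where "D = (R + l)\<^sup>2"
    have "0 < D" using Rl by (simp add: D_def)
    then show ?thesis
      unfolding k_def D_def[symmetric] by (simp add: power2_eq_square field_simps)
  qed
  finally have "pi * s\<^sup>2 / 4 * (N\<^sup>2 * s\<^sup>2 * c\<^sup>2 / (R + l)\<^sup>2) \<le> pi * s\<^sup>2 / 4 * E" .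
  moreover have "0 < pi * s\<^sup>2 / 4" using \<open>0 < s\<close> by simp
  ultimately have "N\<^sup>2 * s\<^sup>2 * c\<^sup>2 / (R + l)\<^sup>2 \<le> E" by (simp only: mult_le_cancel_left_pos)
  then show ?thesis by (simp only: E_def N_def)
qed

text \<open>Tonelli on the region \<open>d < q * s\<close>: integrating over \<open>q\<close> first
  gives the Gaussian of width \<open>s\<close>, over \<open>s\<close> first the logarithm truncated
  at \<open>q * S\<close>. Equality is lost because the left side omits the scales below 1.\<close>

lemma log_average_gauss_le:
  assumes "1 \<le> S" "0 < d"
  shows "(\<integral>\<^sup>+s. ennreal (exp (- d\<^sup>2 / s\<^sup>2) / s) * indicator {1..S} s \<partial>lborel)
     \<le> (\<integral>\<^sup>+q. ennreal (2 * q * exp (- q\<^sup>2)) * indicator {0<..} q * ennreal (log_cut (q * S) d) \<partial>lborel)"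
proof -
  have "(\<integral>\<^sup>+s. ennreal (exp (- d\<^sup>2 / s\<^sup>2) / s) * indicator {1..S} s \<partial>lborel)
     = (\<integral>\<^sup>+s. (\<integral>\<^sup>+q. ennreal (2 * q * exp (- q\<^sup>2)) * (indicator {0<..} q * (if d < q * s then 1 else 0)
           * (ennreal (1 / s) * indicator {1..S} s)) \<partial>lborel) \<partial>lborel)"
  proof (rule nn_integral_cong)
    fix s :: real
    show "ennreal (exp (- d\<^sup>2 / s\<^sup>2) / s) * indicator {1..S} s
      = (\<integral>\<^sup>+q. ennreal (2 * q * exp (- q\<^sup>2)) * (indicator {0<..} q * (if d < q * s then 1 else 0)
           * (ennreal (1 / s) * indicator {1..S} s)) \<partial>lborel)"
    proof (cases "s \<in> {1..S}")
      case True
      then have "0 < s" by simp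
      have "(\<integral>\<^sup>+q. ennreal (2 * q * exp (- q\<^sup>2)) * (indicator {0<..} q * (if d < q * s then 1 else 0)
           * (ennreal (1 / s) * indicator {1..S} s)) \<partial>lborel)
         = (\<integral>\<^sup>+q. ennreal (2 * 1 * q * exp (- 1 * q\<^sup>2)) * indicator {d / s<..} q * ennreal (1 / s) \<partial>lborel)"
      proof (rule nn_integral_cong)
        fix q :: real
        have "0 < q \<and> d < q * s \<longleftrightarrow> d / s < q"
          using \<open>0 < s\<close> \<open>0 < d\<close> by (auto simp: field_simps zero_less_mult_iff dest: order_less_trans)
        then show "ennreal (2 * q * exp (- q\<^sup>2)) * (indicator {0<..} q * (if d < q * s then 1 else 0)
           * (ennreal (1 / s) * indicator {1..S} s))
           = ennreal (2 * 1 * q * exp (- 1 * q\<^sup>2)) * indicator {d / s<..} q * ennreal (1 / s)"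
          using True by (auto simp: indicator_def)
      qed
      also have "\<dots> = (\<integral>\<^sup>+q. ennreal (2 * 1 * q * exp (- 1 * q\<^sup>2)) * indicator {d / s<..} q \<partial>lborel) * ennreal (1 / s)"
        by (rule nn_integral_multc) measurable
      also have "\<dots> = ennreal (exp (- 1 * (d / s)\<^sup>2)) * ennreal (1 / s)"
        using \<open>0 < s\<close> \<open>0 < d\<close> by (subst gauss_layer) auto
      also have "\<dots> = ennreal (exp (- d\<^sup>2 / s\<^sup>2) / s)"
        using \<open>0 < s\<close> by (simp add: ennreal_mult[symmetric] power_divide)
      finally show ?thesis using True by simp
    qed simp
  qed
  also have "\<dots> = (\<integral>\<^sup>+q. (\<integral>\<^sup>+s. ennreal (2 * q * exp (- q\<^sup>2)) * (indicator {0<..} q * (if d < q * s then 1 else 0)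
           * (ennreal (1 / s) * indicator {1..S} s)) \<partial>lborel) \<partial>lborel)"
    by (rule lborel_pair.Fubini'[symmetric]) measurable
  also have "\<dots> \<le> (\<integral>\<^sup>+q. ennreal (2 * q * exp (- q\<^sup>2)) * indicator {0<..} q * ennreal (log_cut (q * S) d) \<partial>lborel)"
  proof (rule nn_integral_mono)
    fix q :: real
    show "(\<integral>\<^sup>+s. ennreal (2 * q * exp (- q\<^sup>2)) * (indicator {0<..} q * (if d < q * s then 1 else 0)
           * (ennreal (1 / s) * indicator {1..S} s)) \<partial>lborel)
        \<le> ennreal (2 * q * exp (- q\<^sup>2)) * indicator {0<..} q * ennreal (log_cut (q * S) d)"
    proof (cases "0 < q")
      case True
      have "(\<integral>\<^sup>+s. (if d < q * s then 1 else 0) * (ennreal (1 / s) * indicator {1..S} s) \<partial>lborel)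
        \<le> (\<integral>\<^sup>+s. ennreal (1 / s) * indicator {..S} s * indicator {d / q<..} s \<partial>lborel)"
        using True by (intro nn_integral_mono) (auto simp: indicator_def field_simps)
      also have "\<dots> = ennreal (log_cut S (d / q))"
        by (rule log_cut_layer) (use assms True in auto)
      also have "log_cut S (d / q) = log_cut (q * S) d"
        by (simp add: log_cut_def mult.commute)
      finally show ?thesis
        using True by (subst nn_integral_cmult) (auto intro!: mult_left_mono)
    qed simp
  qed
  finally show ?thesis .
qed

section \<open>The density bound\<close>

text \<open>The weight \<open>2 * q * exp (- q^2)\<close> has second moment 1, so the bound for
  radius \<open>q * S\<close> averages to the one for the single radius \<open>S\<close>.\<close>

lemma log_averaged_gauss_energy_le:
  fixes X :: "pt set"
  assumes "finite X" "1 \<le> S"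
    and bound: "\<And>x r. x \<in> X \<Longrightarrow> 0 < r \<Longrightarrow> (\<Sum>y\<in>X - {x}. log_cut r (dist x y)) \<le> pi * r\<^sup>2 / 2"
  shows "(\<integral>\<^sup>+s. ennreal ((\<Sum>x\<in>X. \<Sum>y\<in>X - {x}. exp (- (dist x y)\<^sup>2 / s\<^sup>2)) / s) * indicator {1..S} s \<partial>lborel)
     \<le> ennreal (real (card X) * (pi * S\<^sup>2 / 2))"
proof -
  define w where "w q = ennreal (2 * q * exp (- q\<^sup>2)) * indicator {0<..} q" for q :: real
  have [measurable]: "w \<in> borel_measurable borel" unfolding w_def by measurable
  have "(\<integral>\<^sup>+s. ennreal ((\<Sum>x\<in>X. \<Sum>y\<in>X - {x}. exp (- (dist x y)\<^sup>2 / s\<^sup>2)) / s) * indicator {1..S} s \<partial>lborel)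
     = (\<integral>\<^sup>+s. (\<Sum>x\<in>X. \<Sum>y\<in>X - {x}. ennreal (exp (- (dist x y)\<^sup>2 / s\<^sup>2) / s) * indicator {1..S} s) \<partial>lborel)"
  proof (rule nn_integral_cong)
    fix s :: real
    show "ennreal ((\<Sum>x\<in>X. \<Sum>y\<in>X - {x}. exp (- (dist x y)\<^sup>2 / s\<^sup>2)) / s) * indicator {1..S} s
       = (\<Sum>x\<in>X. \<Sum>y\<in>X - {x}. ennreal (exp (- (dist x y)\<^sup>2 / s\<^sup>2) / s) * indicator {1..S} s)"
    proof (cases "s \<in> {1..S}")
      case True
      then show ?thesis by (simp add: sum_divide_distrib sum_ennreal sum_nonneg)
    qed simp
  qed
  also have "\<dots> = (\<Sum>x\<in>X. \<Sum>y\<in>X - {x}. \<integral>\<^sup>+s. ennreal (exp (- (dist x y)\<^sup>2 / s\<^sup>2) / s) * indicator {1..S} s \<partial>lborel)"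
    by (simp add: nn_integral_sum)
  also have "\<dots> \<le> (\<Sum>x\<in>X. \<Sum>y\<in>X - {x}. \<integral>\<^sup>+q. w q * ennreal (log_cut (q * S) (dist x y)) \<partial>lborel)"
    unfolding w_def by (intro sum_mono log_average_gauss_le \<open>1 \<le> S\<close>) auto
  also have "\<dots> = (\<Sum>x\<in>X. \<integral>\<^sup>+q. w q * ennreal (\<Sum>y\<in>X - {x}. log_cut (q * S) (dist x y)) \<partial>lborel)"
  proof (rule sum.cong)
    fix x assume "x \<in> X"
    have "(\<Sum>y\<in>X - {x}. \<integral>\<^sup>+q. w q * ennreal (log_cut (q * S) (dist x y)) \<partial>lborel)
        = (\<integral>\<^sup>+q. (\<Sum>y\<in>X - {x}. w q * ennreal (log_cut (q * S) (dist x y))) \<partial>lborel)"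
      unfolding log_cut_def by (rule nn_integral_sum[symmetric]) measurable
    then show "(\<Sum>y\<in>X - {x}. \<integral>\<^sup>+q. w q * ennreal (log_cut (q * S) (dist x y)) \<partial>lborel)
      = (\<integral>\<^sup>+q. w q * ennreal (\<Sum>y\<in>X - {x}. log_cut (q * S) (dist x y)) \<partial>lborel)"
      by (simp add: sum_ennreal log_cut_nonneg flip: sum_distrib_left)
  qed simp
  also have "\<dots> \<le> (\<Sum>x\<in>X. \<integral>\<^sup>+q. ennreal (2 * 1 * q * exp (- 1 * q\<^sup>2)) * ennreal (pi * q\<^sup>2) * indicator {0..} q * ennreal (S\<^sup>2 / 2) \<partial>lborel)"
  proof (intro sum_mono nn_integral_mono)
    fix x q assume "x \<in> X"
    show "w q * ennreal (\<Sum>y\<in>X - {x}. log_cut (q * S) (dist x y))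
      \<le> ennreal (2 * 1 * q * exp (- 1 * q\<^sup>2)) * ennreal (pi * q\<^sup>2) * indicator {0..} q * ennreal (S\<^sup>2 / 2)"
    proof (cases "0 < q")
      case True
      then have "(\<Sum>y\<in>X - {x}. log_cut (q * S) (dist x y)) \<le> pi * (q * S)\<^sup>2 / 2"
        using \<open>1 \<le> S\<close> by (intro bound \<open>x \<in> X\<close>) simp
      also have "\<dots> = pi * q\<^sup>2 * (S\<^sup>2 / 2)" by (simp add: power_mult_distrib)
      finally have "w q * ennreal (\<Sum>y\<in>X - {x}. log_cut (q * S) (dist x y)) \<le> w q * ennreal (pi * q\<^sup>2 * (S\<^sup>2 / 2))"
        by (intro mult_left_mono ennreal_leI) auto
      also have "ennreal (pi * q\<^sup>2 * (S\<^sup>2 / 2)) = ennreal (pi * q\<^sup>2) * ennreal (S\<^sup>2 / 2)"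
        by (rule ennreal_mult) auto
      finally show ?thesis using True by (simp add: w_def mult.assoc)
    qed (simp add: w_def)
  qed
  also have "\<dots> = (\<Sum>x\<in>X. ennreal (pi / 1) * ennreal (S\<^sup>2 / 2))"
  proof (rule sum.cong)
    fix x
    show "(\<integral>\<^sup>+q. ennreal (2 * 1 * q * exp (- 1 * q\<^sup>2)) * ennreal (pi * q\<^sup>2) * indicator {0..} q * ennreal (S\<^sup>2 / 2) \<partial>lborel)
      = ennreal (pi / 1) * ennreal (S\<^sup>2 / 2)"
      by (subst nn_integral_multc) (use nn_integral_q3_gauss[of 1] in auto)
  qed simp
  also have "\<dots> = ennreal (real (card X) * (pi * S\<^sup>2 / 2))"
    by (simp add: ennreal_mult[symmetric] ennreal_of_nat_eq_real_of_nat)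
  finally show ?thesis .
qed

text \<open>The inequality \<open>A * s^2 \<le> E s + N\<close> is integrated against
  \<open>ds / s\<close> from 1 to \<open>S\<close>. Since \<open>A\<close> is quadratic in
  \<open>N\<close>, one factor \<open>N\<close> cancels and a bound on \<open>N\<close>
  remains.\<close>

lemma card_le_of_log_cut_bound:
  fixes X :: "pt set"
  assumes X: "finite X" "X \<subseteq> ball a R" and "0 < R" "0 \<le> l" "1 < S"
    and c: "0 < c" "c \<le> 1 - 2 * exp (- l\<^sup>2 / S\<^sup>2)"
    and bound: "\<And>x r. x \<in> X \<Longrightarrow> 0 < r \<Longrightarrow> (\<Sum>y\<in>X - {x}. log_cut r (dist x y)) \<le> pi * r\<^sup>2 / 2"
  shows "real (card X) \<le> (R + l)\<^sup>2 * (pi * S\<^sup>2 + 2 * ln S) / (c\<^sup>2 * (S\<^sup>2 - 1))"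
proof (cases "card X = 0")
  case True
  have "0 \<le> ln S" using \<open>1 < S\<close> by simp
  moreover have "1 \<le> S\<^sup>2" using \<open>1 < S\<close> by simp
  ultimately show ?thesis using True by (simp add: divide_nonneg_nonneg)
next
  case False
  define N where "N = real (card X)"
  have N: "0 < N" using False by (simp add: N_def)
  have Rl: "0 < R + l" using assms by simp
  define A where "A = N\<^sup>2 * c\<^sup>2 / (R + l)\<^sup>2"
  have A0: "0 \<le> A" by (simp add: A_def)
  define E where "E s = (\<Sum>x\<in>X. \<Sum>y\<in>X - {x}. exp (- (dist x y)\<^sup>2 / s\<^sup>2))" for s
  have E0: "0 \<le> E s" for s by (simp add: E_def sum_nonneg)
  have AE: "A * s\<^sup>2 \<le> E s + N" if "s \<in> {1..S}" for s
  proof -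
    \<comment> \<open>The leakage \<open>exp (- l^2 / s^2)\<close> increases with \<open>s\<close>,
      so a \<open>c\<close> valid at scale \<open>S\<close> is valid at all smaller scales.\<close>
    have "- l\<^sup>2 / s\<^sup>2 \<le> - l\<^sup>2 / S\<^sup>2"
      using that by (auto intro!: divide_left_mono power_mono simp: zero_less_power)
    then have "c \<le> 1 - 2 * exp (- l\<^sup>2 / s\<^sup>2)"
      using c(2) by (smt (verit) exp_le_cancel_iff)
    then have "N\<^sup>2 * s\<^sup>2 * c\<^sup>2 / (R + l)\<^sup>2 \<le> (\<Sum>x\<in>X. \<Sum>y\<in>X. exp (- (dist x y)\<^sup>2 / s\<^sup>2))"
      unfolding N_def using that c assms by (intro gauss_energy_ge[OF X]) auto
    also have "\<dots> = (\<Sum>x\<in>X. 1 + (\<Sum>y\<in>X - {x}. exp (- (dist x y)\<^sup>2 / s\<^sup>2)))"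
      by (rule sum.cong) (simp_all add: sum.remove[OF X(1)])
    also have "\<dots> = E s + N" by (simp add: sum.distrib E_def N_def)
    finally show ?thesis by (simp add: A_def mult_ac)
  qed
  have "ennreal (A * S\<^sup>2 / 2 - A * 1\<^sup>2 / 2) = (\<integral>\<^sup>+s. ennreal (A * s) * indicator {1..S} s \<partial>lborel)"
    by (rule nn_integral_FTC_Icc[symmetric])
      (use A0 \<open>1 < S\<close> in \<open>auto intro!: derivative_eq_intros\<close>)
  also have "\<dots> \<le> (\<integral>\<^sup>+s. ennreal (E s / s) * indicator {1..S} s + ennreal N * (ennreal (1 / s) * indicator {1..S} s) \<partial>lborel)"
  proof (rule nn_integral_mono)
    fix s :: real
    show "ennreal (A * s) * indicator {1..S} s
      \<le> ennreal (E s / s) * indicator {1..S} s + ennreal N * (ennreal (1 / s) * indicator {1..S} s)"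
    proof (cases "s \<in> {1..S}")
      case True
      then have "A * s \<le> E s / s + N * (1 / s)"
        using AE[OF True] by (simp add: field_simps power2_eq_square)
      then have "ennreal (A * s) \<le> ennreal (E s / s + N * (1 / s))" by (rule ennreal_leI)
      also have "\<dots> = ennreal (E s / s) + ennreal N * ennreal (1 / s)"
        using True E0[of s] N by (subst ennreal_plus) (auto simp: ennreal_mult[symmetric])
      finally show ?thesis using True by simp
    qed simp
  qed
  also have "\<dots> = (\<integral>\<^sup>+s. ennreal (E s / s) * indicator {1..S} s \<partial>lborel) + ennreal N * ennreal (ln S - ln 1)"
    unfolding E_def using nn_integral_inverse_Icc[of 1 S] \<open>1 < S\<close>
    by (subst nn_integral_add) (auto simp: nn_integral_cmult)
  also have "(\<integral>\<^sup>+s. ennreal (E s / s) * indicator {1..S} s \<partial>lborel) \<le> ennreal (N * (pi * S\<^sup>2 / 2))"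
    unfolding E_def N_def using \<open>1 < S\<close> by (intro log_averaged_gauss_energy_le X(1) bound) auto
  also have "ennreal (N * (pi * S\<^sup>2 / 2)) + ennreal N * ennreal (ln S - ln 1) = ennreal (N * (pi * S\<^sup>2 / 2) + N * ln S)"
    using N \<open>1 < S\<close> by (simp add: ennreal_mult[symmetric])
  finally have "ennreal (A * S\<^sup>2 / 2 - A * 1\<^sup>2 / 2) \<le> ennreal (N * (pi * S\<^sup>2 / 2) + N * ln S)"
    by (simp add: add_right_mono)
  moreover have "0 \<le> N * (pi * S\<^sup>2 / 2) + N * ln S" using N \<open>1 < S\<close> by simp
  ultimately have A: "A * (S\<^sup>2 - 1) \<le> N * (pi * S\<^sup>2 + 2 * ln S)"
    by (simp add: ennreal_le_iff algebra_simps)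
  have "N * (N * (c\<^sup>2 * (S\<^sup>2 - 1))) \<le> N * ((R + l)\<^sup>2 * (pi * S\<^sup>2 + 2 * ln S))"
  proof -
    define D where "D = (R + l)\<^sup>2"
    have "0 < D" using Rl by (simp add: D_def)
    then show ?thesis
      using A
      unfolding A_def D_def[symmetric] by (simp add: power2_eq_square field_simps)
  qed
  then have "N * (c\<^sup>2 * (S\<^sup>2 - 1)) \<le> (R + l)\<^sup>2 * (pi * S\<^sup>2 + 2 * ln S)"
    using N by (simp only: mult_le_cancel_left_pos)
  moreover have "0 < c\<^sup>2 * (S\<^sup>2 - 1)" using c(1) \<open>1 < S\<close> by simp
  ultimately show ?thesis by (simp add: pos_le_divide_eq N_def)
qed

lemma n_max_le:
  assumes "0 < R" "0 \<le> l" "1 < S" "0 < c" "c \<le> 1 - 2 * exp (- l\<^sup>2 / S\<^sup>2)"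
  shows "n_max a R \<le> ereal ((R + l)\<^sup>2 * (pi * S\<^sup>2 + 2 * ln S) / (c\<^sup>2 * (S\<^sup>2 - 1)))"
  unfolding n_max_def
proof (rule Sup_least, safe)
  fix X :: "pt set" assume "finite X" "X \<subseteq> ball a R" "exclusion_rule X"
  then show "ereal (real (card X)) \<le> ereal ((R + l)\<^sup>2 * (pi * S\<^sup>2 + 2 * ln S) / (c\<^sup>2 * (S\<^sup>2 - 1)))"
    using assms by (auto intro!: card_le_of_log_cut_bound exclusion_rule_log_cut_sum_le)
qed

theorem theorem4p3:
  fixes a :: "real ^ 2"
  shows "Limsup at_top (\<lambda>R. n_max a R / ereal (pi * R\<^sup>2)) \<le> 1"
proof -
  \<comment> \<open>The density bound left after \<open>R\<close> has gone to infinity, for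
    \<open>l = S^2\<close> and \<open>c = 1 - 2 * exp (- S^2)\<close>. This \<open>l\<close> is
    negligible against \<open>R\<close> for fixed \<open>S\<close>, yet \<open>l / S\<close> grows
    with \<open>S\<close>, which drives \<open>c\<close> to 1.\<close>
  define q where "q S = (pi * S\<^sup>2 + 2 * ln S) / ((1 - 2 * exp (- S\<^sup>2))\<^sup>2 * (S\<^sup>2 - 1)) / pi" for S :: real
  have q1: "(q \<longlongrightarrow> 1) at_top"
    unfolding q_def by real_asymp
  have le: "Limsup at_top (\<lambda>R. n_max a R / ereal (pi * R\<^sup>2)) \<le> ereal (q S)"
    if "1 < S" "0 < 1 - 2 * exp (- S\<^sup>2)" for S
  proof -
    have "\<forall>\<^sub>F R in at_top. n_max a R / ereal (pi * R\<^sup>2) \<le> ereal ((R + S\<^sup>2)\<^sup>2 / R\<^sup>2 * q S)"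
      using eventually_gt_at_top[of 0]
    proof eventually_elim
      case (elim R)
      have "(S\<^sup>2)\<^sup>2 / S\<^sup>2 = S\<^sup>2" using that by (simp add: power2_eq_square)
      then have "n_max a R \<le> ereal ((R + S\<^sup>2)\<^sup>2 * (pi * S\<^sup>2 + 2 * ln S) / ((1 - 2 * exp (- S\<^sup>2))\<^sup>2 * (S\<^sup>2 - 1)))"
        using that elim by (intro n_max_le) auto
      then have "n_max a R / ereal (pi * R\<^sup>2)
          \<le> ereal ((R + S\<^sup>2)\<^sup>2 * (pi * S\<^sup>2 + 2 * ln S) / ((1 - 2 * exp (- S\<^sup>2))\<^sup>2 * (S\<^sup>2 - 1))) / ereal (pi * R\<^sup>2)"
        using elim by (intro ereal_divide_right_mono) auto
      also have "\<dots> = ereal ((R + S\<^sup>2)\<^sup>2 / R\<^sup>2 * q S)"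
        using elim by (simp add: q_def)
      finally show ?case .
    qed
    then have "Limsup at_top (\<lambda>R. n_max a R / ereal (pi * R\<^sup>2))
        \<le> Limsup at_top (\<lambda>R. ereal ((R + S\<^sup>2)\<^sup>2 / R\<^sup>2 * q S))"
      by (rule Limsup_mono)
    also have "((\<lambda>R. (R + S\<^sup>2)\<^sup>2 / R\<^sup>2) \<longlongrightarrow> 1) at_top" by real_asymp
    then have "((\<lambda>R. ereal ((R + S\<^sup>2)\<^sup>2 / R\<^sup>2 * q S)) \<longlongrightarrow> ereal (1 * q S)) at_top"
      by (intro tendsto_intros)
    then have "Limsup at_top (\<lambda>R. ereal ((R + S\<^sup>2)\<^sup>2 / R\<^sup>2 * q S)) = ereal (1 * q S)"
      by (intro lim_imp_Limsup) simp_all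
    finally show ?thesis by simp
  qed
  have "\<forall>\<^sub>F S in at_top. 0 < 1 - 2 * exp (- S\<^sup>2 :: real)" by real_asymp
  then have "\<forall>\<^sub>F S in at_top. Limsup at_top (\<lambda>R. n_max a R / ereal (pi * R\<^sup>2)) \<le> ereal (q S)"
    using eventually_gt_at_top[of 1] by eventually_elim (rule le)
  moreover have "((\<lambda>S. ereal (q S)) \<longlongrightarrow> 1) at_top"
    using q1 by (simp add: one_ereal_def)
  ultimately show ?thesis
    by (intro tendsto_lowerbound) auto
qed

end
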